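(* Let $\ell\in\mathbb{N}$, $\ell\ge2$. There exists $\varepsilon_0>0$ such that the following holds. If $\Omega_*:\mathbb{T}^2\to\mathbb{R}$ satisfies $$\mathbb{P}_K(\Omega_*-\cos(y))=a\,\big(\sin(\ell y)+\cos(x)\big)\quad\text{for some }a>0$$ and $\|\Omega_*-\cos(y)\|_{H^6}=\varepsilon<\varepsilon_0$, then $\Omega_*$ is not (the vorticity of) a stationary solution to the 2d Euler equations on $\mathbb{T}^2$.
   Context: $\mathbb{T}^2=(\mathbb{R}/2\pi\mathbb{Z})^2$ with coordinates $(x,y)$. The 2d Euler equations in vorticity form are $\partial_t\Omega+U\cdot\nabla\Omega=0$, $U=\nabla^\perp\Delta^{-1}\Omega$, $\nabla^\perp=(-\partial_y,\partial_x)$. The operator $\mathcal{L}_K:=\sin(y)(1+\Delta^{-1})\partial_x$ has kernel consisting of the sums of functions in $\mathrm{span}\{\cos x,\sin x\}$ and functions $f\in L^2$ with $\partial_xf\equiv0$; $\mathbb{P}_K$ is the $L^2$-orthogonal projection onto $\ker\mathcal{L}_K$. *)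

theory Defs
  imports "HOL-Analysis.Analysis"
begin

text \<open>Functions on \<open>\<T>\<^sup>2 = (\<real>/2\<pi>\<int>)\<^sup>2\<close> are doubly \<open>2\<pi>\<close>-periodic functions on \<open>\<real> \<times> \<real>\<close>.
  Integrals and almost-everywhere statements use a half-open fundamental domain.\<close>

definition periodic2 :: "(real \<times> real \<Rightarrow> real) \<Rightarrow> bool" where
  "periodic2 f \<longleftrightarrow>
     (\<forall>x y. f (x + 2 * pi, y) = f (x, y) \<and> f (x, y + 2 * pi) = f (x, y))"

definition torus :: "(real \<times> real) measure" where
  "torus = restrict_space lebesgue ({0..<2 * pi} \<times> {0..<2 * pi})"

text \<open>Elements of \<open>L\<^sup>2\<close> are represented by functions; no quotient by null functions is taken,
  and all notions below are invariant under changes on null sets. For this reason operators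
  on \<open>L\<^sup>2\<close> are rendered by their graphs, i.e. as relations between functions.\<close>

definition L2 :: "(real \<times> real \<Rightarrow> real) set" where
  "L2 = {f. periodic2 f \<and> f \<in> borel_measurable torus \<and> integrable torus (\<lambda>p. (f p)\<^sup>2)}"

definition fourier_coeff :: "(real \<times> real \<Rightarrow> real) \<Rightarrow> int \<times> int \<Rightarrow> complex" where
  "fourier_coeff f = (\<lambda>(m, n).
     (LINT (x, y)|torus. complex_of_real (f (x, y)) * cis (- (of_int m * x + of_int n * y)))
       / complex_of_real (4 * pi\<^sup>2))"

text \<open>The factor \<open>2\<pi>\<close> in the norm makes \<open>H\<^sup>0\<close> isometric to \<open>L\<^sup>2\<close> for the measure \<open>dx dy\<close>.\<close>

definition sobolev_weight :: "nat \<Rightarrow> int \<times> int \<Rightarrow> real" where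
  "sobolev_weight s = (\<lambda>(m, n). (1 + (of_int m)\<^sup>2 + (of_int n)\<^sup>2) ^ s)"

definition sobolev :: "nat \<Rightarrow> (real \<times> real \<Rightarrow> real) set" where
  "sobolev s = {f \<in> L2. (\<lambda>k. sobolev_weight s k * (cmod (fourier_coeff f k))\<^sup>2) summable_on UNIV}"

definition sobolev_norm :: "nat \<Rightarrow> (real \<times> real \<Rightarrow> real) \<Rightarrow> real" where
  "sobolev_norm s f =
     2 * pi * sqrt (\<Sum>\<^sub>\<infinity>k. sobolev_weight s k * (cmod (fourier_coeff f k))\<^sup>2)"

text \<open>Derivatives are taken in the sense of distributions on the torus and are required to lie
  in \<open>L\<^sup>2\<close>; this is expressed by testing against the exponentials.\<close>

definition is_dx :: "(real \<times> real \<Rightarrow> real) \<Rightarrow> (real \<times> real \<Rightarrow> real) \<Rightarrow> bool" where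
  "is_dx f g \<longleftrightarrow> f \<in> L2 \<and> g \<in> L2 \<and>
     (\<forall>m n. fourier_coeff g (m, n) = \<i> * of_int m * fourier_coeff f (m, n))"

definition is_dy :: "(real \<times> real \<Rightarrow> real) \<Rightarrow> (real \<times> real \<Rightarrow> real) \<Rightarrow> bool" where
  "is_dy f g \<longleftrightarrow> f \<in> L2 \<and> g \<in> L2 \<and>
     (\<forall>m n. fourier_coeff g (m, n) = \<i> * of_int n * fourier_coeff f (m, n))"

text \<open>\<open>is_inv_laplacian f g\<close> says \<open>g = \<Delta>\<^sup>-\<^sup>1 f\<close>: \<open>g\<close> is the solution of \<open>\<Delta>g = f\<close> of mean zero.
  The mode \<open>(0, 0)\<close> of the equation forces \<open>f\<close> to have mean zero.\<close>

definition is_inv_laplacian :: "(real \<times> real \<Rightarrow> real) \<Rightarrow> (real \<times> real \<Rightarrow> real) \<Rightarrow> bool" where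
  "is_inv_laplacian f g \<longleftrightarrow> f \<in> L2 \<and> g \<in> L2 \<and> fourier_coeff g (0, 0) = 0 \<and>
     (\<forall>m n. - ((of_int m)\<^sup>2 + (of_int n)\<^sup>2) * fourier_coeff g (m, n) = fourier_coeff f (m, n))"

text \<open>\<open>is_LK f h\<close> says \<open>h = sin(y) (1 + \<Delta>\<^sup>-\<^sup>1) \<partial>\<^sub>x f\<close>.\<close>

definition is_LK :: "(real \<times> real \<Rightarrow> real) \<Rightarrow> (real \<times> real \<Rightarrow> real) \<Rightarrow> bool" where
  "is_LK f h \<longleftrightarrow> h \<in> L2 \<and>
     (\<exists>g w. is_dx f g \<and> is_inv_laplacian g w \<and>
        (AE (x, y) in torus. h (x, y) = sin y * (g (x, y) + w (x, y))))"

definition ker_LK :: "(real \<times> real \<Rightarrow> real) set" where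
  "ker_LK = {f. is_LK f (\<lambda>_. 0)}"

definition is_orth_proj ::
  "(real \<times> real \<Rightarrow> real) set \<Rightarrow> (real \<times> real \<Rightarrow> real) \<Rightarrow> (real \<times> real \<Rightarrow> real) \<Rightarrow> bool" where
  "is_orth_proj V f p \<longleftrightarrow> f \<in> L2 \<and> p \<in> V \<and> (\<forall>q\<in>V. (LINT z|torus. (f z - p z) * q z) = 0)"

abbreviation is_PK :: "(real \<times> real \<Rightarrow> real) \<Rightarrow> (real \<times> real \<Rightarrow> real) \<Rightarrow> bool" where
  "is_PK \<equiv> is_orth_proj ker_LK"

text \<open>\<open>U \<cdot> \<nabla>\<Omega> = 0\<close> almost everywhere, with stream function \<open>\<psi> = \<Delta>\<^sup>-\<^sup>1 \<Omega>\<close> and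
  \<open>U = (-\<partial>\<^sub>y\<psi>, \<partial>\<^sub>x\<psi>)\<close>. This is meaningful for \<open>\<Omega>\<close> of mean zero with square integrable
  gradient.\<close>

definition stationary_euler :: "(real \<times> real \<Rightarrow> real) \<Rightarrow> bool" where
  "stationary_euler \<Omega> \<longleftrightarrow>
     (\<exists>\<psi> \<psi>x \<psi>y \<Omega>x \<Omega>y.
        is_inv_laplacian \<Omega> \<psi> \<and> is_dx \<psi> \<psi>x \<and> is_dy \<psi> \<psi>y \<and> is_dx \<Omega> \<Omega>x \<and> is_dy \<Omega> \<Omega>y \<and>
        (AE z in torus. - \<psi>y z * \<Omega>x z + \<psi>x z * \<Omega>y z = 0))"

end

theory Submission
  imports Defs
begin

text \<open>Write \<open>\<omega> = \<Omega> - cos y = a (sin (l y) + cos x) + \<eta>\<close> with \<open>\<eta>\<close> orthogonal to the kernel of \<open>\<L>\<^sub>K\<close>.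
  Stationarity reads \<open>\<L>\<^sub>K \<eta> = N\<close>, where \<open>N = \<nabla>\<^sup>\<bottom>\<Delta>\<^sup>-\<^sup>1 \<omega> \<cdot> \<nabla>\<omega>\<close>. The left side vanishes at \<open>y = 0\<close>, because
  \<open>\<L>\<^sub>K\<close> contains the factor \<open>sin y\<close>; the leading part \<open>a\<^sup>2 (l - 1/l) sin x cos (l y)\<close> of \<open>N\<close> does not.
  Hence \<open>a\<^sup>2\<close> is controlled by the terms of \<open>N\<close> that involve \<open>\<eta>\<close>. Conversely, dividing by \<open>sin y\<close> costs
  one derivative and bounds \<open>\<eta>\<close> by \<open>N\<close>, so that interpolation with the smallness in \<open>H\<^sup>6\<close>
  gives \<open>\<eta> = O(a\<^sup>2)\<close>; then the terms of \<open>N\<close> with \<open>\<eta>\<close> are \<open>o(a\<^sup>2)\<close>, a contradiction.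
  All norms are weighted \<open>\<ell>\<^sup>1\<close> norms of Fourier coefficients.\<close>

section \<open>Uniqueness of Fourier coefficients on the torus\<close>

text \<open>The amplitude \<open>a\<close> has no lower bound, so every error must be small relative
  to \<open>a^2\<close>, with a threshold depending on \<open>l\<close> alone. Summable coefficients
  suit this: products become convolutions, the value at y = 0 of the m-th mode in x is a sum over n,
  and division by sin y inverts a recurrence in n. The derivative lost there is harmless, because
  the multiplier of N absorbs a factor |n| (\<open>euler_kernel_bounds\<close>). Let X0, X2, X4 be
  the sums of |\<eta>| with weights 1, \<open>wt\<close>, \<open>wt^2\<close>, and W the
  \<open>wt\<close>-weighted sum for sin(l y) + cos x. N still costs derivatives of its second
  argument, so the inversion yields only X0 <= 4 (a W + X2)^2, which is not closed. The
  interpolation X2^2 <= X0 X4 closes it, since X4 is small by the H^6 bound. The bound O(a^2) thus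
  concerns X0; for X2 the result is \<open>a\<close> times a small factor. This suffices, as the
  remainder at y = 0 is at most a W X2 + X2 (a W + X2).\<close>

definition fexp :: "int \<times> int \<Rightarrow> real \<times> real \<Rightarrow> complex" where
  "fexp k z = cis (of_int (fst k) * fst z + of_int (snd k) * snd z)"

lemma fexp_add: "fexp (j + k) z = fexp j z * fexp k z"
  by (simp add: fexp_def cis_mult algebra_simps)

lemma fexp_0 [simp]: "fexp 0 z = 1"
  by (simp add: fexp_def)

lemma norm_fexp [simp]: "cmod (fexp k z) = 1"
  by (simp add: fexp_def)

lemma cnj_fexp: "cnj (fexp k z) = fexp (- k) z"
  by (simp add: fexp_def cis_cnj)

lemma continuous_fexp: "continuous_on A (fexp k)"
  unfolding fexp_def by (intro continuous_intros)

lemma space_torus: "space torus = {0..<2 * pi} \<times> {0..<2 * pi}"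
  by (simp add: torus_def space_restrict_space)

lemma torus_domain_borel: "({0..<2 * pi} \<times> {0..<2 * pi} :: (real \<times> real) set) \<in> sets borel"
  by (intro borel_Times) auto

lemma torus_domain_lebesgue: "({0..<2 * pi} \<times> {0..<2 * pi} :: (real \<times> real) set) \<in> sets lebesgue"
  using torus_domain_borel by (metis sets_completionI_sets sets_lborel)

lemma measurable_torus_borel: "f \<in> borel_measurable borel \<Longrightarrow> f \<in> borel_measurable torus"
  unfolding torus_def by (intro measurable_restrict_space1) (auto intro: borel_measurable_if_I measurable_completion)

lemma measurable_torus_continuous:
  fixes f :: "real \<times> real \<Rightarrow> 'b::topological_space"
  shows "continuous_on UNIV f \<Longrightarrow> f \<in> borel_measurable torus"
  by (intro measurable_torus_borel borel_measurable_continuous_onI)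

lemma measurable_fexp [measurable]: "fexp k \<in> borel_measurable torus"
  by (intro measurable_torus_continuous continuous_fexp)

lemma finite_measure_torus: "finite_measure torus"
proof (rule finite_measureI)
  have "bounded ({0..<2 * pi} \<times> {0..<2 * pi} :: (real \<times> real) set)"
    by (intro bounded_Times) auto
  then have "({0..<2 * pi} \<times> {0..<2 * pi} :: (real \<times> real) set) \<in> lmeasurable"
    by (intro bounded_set_imp_lmeasurable torus_domain_lebesgue)
  then show "emeasure torus (space torus) \<noteq> \<infinity>"
    unfolding space_torus torus_def
    by (subst emeasure_restrict_space) (auto simp: torus_domain_lebesgue fmeasurable_def)
qed

interpretation torus: finite_measure torus
  by (rule finite_measure_torus)

lemma integrable_torus_bounded:
  fixes f :: "real \<times> real \<Rightarrow> complex"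
  assumes "f \<in> borel_measurable torus" "\<And>z. cmod (f z) \<le> C"
  shows "integrable torus f"
  using assms by (intro torus.integrable_const_bound[where B = C]) auto

lemma measurable_cis_mult [measurable]: "(\<lambda>x. cis (c * x)) \<in> borel_measurable borel"
  by (intro borel_measurable_continuous_onI continuous_intros)

lemma integral_cis_period:
  "(LBINT x. indicator {0..<2 * pi} x *\<^sub>R cis (of_int n * x)) = (if n = 0 then complex_of_real (2 * pi) else 0)"
proof -
  \<comment> \<open>The fundamental theorem of calculus below is stated for closed intervals; the
    added endpoint is a null set.\<close>
  have eq: "(LBINT x. indicator {0..<2 * pi} x *\<^sub>R cis (of_int n * x)) =
            (LBINT x. indicator {0..2 * pi} x *\<^sub>R cis (of_int n * x))"
  proof (intro integral_cong_AE)
    show "AE x in lborel. indicator {0..<2 * pi} x *\<^sub>R cis (of_int n * x) =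
        indicator {0..2 * pi} x *\<^sub>R cis (of_int n * x)"
      using AE_lborel_singleton[of "2 * pi"] by eventually_elim (auto simp: indicator_def)
  qed simp_all
  show ?thesis
  proof (cases "n = 0")
    case True
    then show ?thesis
      unfolding eq by (simp add: scaleR_conv_of_real)
  next
    case False
    have "(LBINT x. indicator {0..2 * pi} x *\<^sub>R cis (of_int n * x)) =
        cis (of_int n * (2 * pi)) / (\<i> * of_int n) - cis (of_int n * 0) / (\<i> * of_int n)"
    proof (rule integral_FTC_atLeastAtMost)
      show "((\<lambda>x. cis (of_int n * x) / (\<i> * of_int n)) has_vector_derivative cis (of_int n * x))
          (at x within {0..2 * pi})" for x
        unfolding cis_conv_exp using False
        by (auto intro!: derivative_eq_intros has_vector_derivative_real_field simp: field_simps)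
    qed (auto intro!: continuous_intros)
    also have "cis (of_int n * (2 * pi)) = 1"
      by (metis cis_multiple_2pi mult.commute Ints_of_int mult.assoc)
    finally show ?thesis
      using False eq by simp
  qed
qed

lemma integral_fexp: "(LINT z|torus. fexp k z) = (if k = 0 then complex_of_real (4 * pi\<^sup>2) else 0)"
proof -
  obtain m n where k: "k = (m, n)" by fastforce
  let ?c = "\<lambda>n x. indicator {0..<2 * pi} x *\<^sub>R cis (of_int n * x)"
  have int: "integrable lborel (?c n)" for n
  proof (rule Bochner_Integration.integrable_bound[where f = "indicator {0..<2 * pi} :: real \<Rightarrow> real"])
    show "integrable lborel (indicator {0..<2 * pi} :: real \<Rightarrow> real)"
      by (subst integrable_indicator_iff) auto
  qed simp_all
  have m: "(\<lambda>z. indicator ({0..<2 * pi} \<times> {0..<2 * pi}) z *\<^sub>R fexp k z) \<in> borel_measurable lborel"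
    using torus_domain_borel borel_measurable_continuous_onI[OF continuous_fexp]
    by (intro borel_measurable_scaleR) auto
  have "(LINT z|torus. fexp k z) = (LINT z|lebesgue. indicator ({0..<2 * pi} \<times> {0..<2 * pi}) z *\<^sub>R fexp k z)"
    unfolding torus_def using torus_domain_lebesgue by (subst integral_restrict_space) auto
  also have "\<dots> = (LINT z|lborel. indicator ({0..<2 * pi} \<times> {0..<2 * pi}) z *\<^sub>R fexp k z)"
    using m by (rule integral_completion)
  also have "\<dots> = (LINT z|(lborel \<Otimes>\<^sub>M lborel). ?c m (fst z) * ?c n (snd z))"
    unfolding lborel_prod
    by (intro Bochner_Integration.integral_cong) (auto simp: indicator_def fexp_def k cis_mult)
  also have "\<dots> = (LINT x|lborel. LINT y|lborel. ?c m x * ?c n y)"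
  proof (subst lborel_pair.integral_fst'[symmetric])
    show "integrable (lborel \<Otimes>\<^sub>M lborel) (\<lambda>z. ?c m (fst z) * ?c n (snd z))"
    proof (rule lborel_pair.Fubini_integrable)
      show "(\<lambda>z. ?c m (fst z) * ?c n (snd z)) \<in> borel_measurable (lborel \<Otimes>\<^sub>M lborel)"
        using int[of m] int[of n] by measurable
    next
      show "integrable lborel (\<lambda>x. LBINT y. cmod (?c m (fst (x, y)) * ?c n (snd (x, y))))"
        using int[of m] int[of n] by (simp add: norm_mult)
      show "AE x in lborel. integrable lborel (\<lambda>y. ?c m (fst (x, y)) * ?c n (snd (x, y)))"
        using int[of n] by (auto simp del: mult_scaleR_left mult_scaleR_right intro: integrable_mult_right)
    qed
  qed simp
  also have "\<dots> = (LINT x|lborel. ?c m x) * (LINT y|lborel. ?c n y)"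
    by (simp del: mult_scaleR_left mult_scaleR_right)
  finally show ?thesis
    unfolding integral_cis_period k by (simp add: power2_eq_square zero_prod_def)
qed

section \<open>Density: from characters to continuous functions and compact sets\<close>

lemma integrable_mult_bounded:
  fixes h b :: "real \<times> real \<Rightarrow> complex"
  assumes h: "integrable torus h" and b: "b \<in> borel_measurable torus"
    and le: "\<And>z. z \<in> space torus \<Longrightarrow> cmod (b z) \<le> C"
  shows "integrable torus (\<lambda>z. h z * b z)"
proof (rule Bochner_Integration.integrable_bound[where f = "\<lambda>z. C * cmod (h z)"])
  show "integrable torus (\<lambda>z. C * cmod (h z))"
    using h by simp
  show "(\<lambda>z. h z * b z) \<in> borel_measurable torus"
    using h b by simp
  show "AE z in torus. cmod (h z * b z) \<le> norm (C * cmod (h z))"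
  proof (rule AE_I2)
    fix z assume "z \<in> space torus"
    then have "cmod (h z) * cmod (b z) \<le> cmod (h z) * C"
      by (intro mult_left_mono le) auto
    also have "\<dots> \<le> norm (C * cmod (h z))"
      by (metis abs_ge_self mult.commute real_norm_def)
    finally show "cmod (h z * b z) \<le> norm (C * cmod (h z))"
      by (simp add: norm_mult)
  qed
qed

lemma integrable_mult_fexp:
  "integrable torus h \<Longrightarrow> integrable torus (\<lambda>z. h z * fexp k z)"
  by (rule integrable_mult_bounded[where C = 1]) auto

text \<open>Gluing the fundamental domain into a compact subset of a real vector space makes
  Stone-Weierstrass applicable: polynomials in the coordinates become trigonometric polynomials on
  the torus.\<close>

definition torus_embed :: "real \<times> real \<Rightarrow> complex \<times> complex" where
  "torus_embed z = (cis (fst z), cis (snd z))"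

lemma continuous_torus_embed: "continuous_on S torus_embed"
  unfolding torus_embed_def by (intro continuous_intros)

lemma torus_embed_in: "torus_embed z \<in> sphere 0 1 \<times> sphere 0 1"
  by (simp add: torus_embed_def)

lemma inj_on_torus_embed: "inj_on torus_embed (space torus)"
proof -
  have "inj_on cis {0..<2 * pi}"
    by (rule inj_on_inverseI[where g = Arg2pi]) (auto simp: cis_conv_exp Arg2pi_exp mult.commute)
  then show ?thesis
    by (auto simp: inj_on_def torus_embed_def space_torus)
qed

text \<open>The real coordinates of the embedding are cos x, sin x, cos y, sin y, so a linear
  functional pulls back to a combination of the four characters of degree one. This is the base case
  for polynomials.\<close>

lemma bounded_linear_torus_embed:
  fixes f :: "complex \<times> complex \<Rightarrow> real"
  assumes "bounded_linear f"
  obtains A B where "\<And>z. complex_of_real (f (torus_embed z)) =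
    A * fexp (1, 0) z + cnj A * fexp (- 1, 0) z + B * fexp (0, 1) z + cnj B * fexp (0, - 1) z"
proof
  fix z
  interpret f: bounded_linear f by fact
  have "torus_embed z = cos (fst z) *\<^sub>R (1, 0) + sin (fst z) *\<^sub>R (\<i>, 0)
      + cos (snd z) *\<^sub>R (0, 1) + sin (snd z) *\<^sub>R (0, \<i>)"
    by (simp add: torus_embed_def complex_eq_iff)
  then have "f (torus_embed z) = cos (fst z) * f (1, 0) + sin (fst z) * f (\<i>, 0)
      + cos (snd z) * f (0, 1) + sin (snd z) * f (0, \<i>)"
    by (simp only: f.add f.scaleR real_scaleR_def)
  then show "complex_of_real (f (torus_embed z)) =
    Complex (f (1, 0) / 2) (- f (\<i>, 0) / 2) * fexp (1, 0) z
    + cnj (Complex (f (1, 0) / 2) (- f (\<i>, 0) / 2)) * fexp (- 1, 0) z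
    + Complex (f (0, 1) / 2) (- f (0, \<i>) / 2) * fexp (0, 1) z
    + cnj (Complex (f (0, 1) / 2) (- f (0, \<i>) / 2)) * fexp (0, - 1) z"
    by (simp add: complex_eq_iff fexp_def field_simps)
qed

text \<open>Being orthogonal to all characters is preserved under multiplication by a trigonometric
  polynomial, since characters multiply to characters. The induction keeps \<open>h\<close>
  arbitrary so that in the product case the second factor can be applied to \<open>h\<close> times
  the first.\<close>

lemma integral_polynomial_torus:
  fixes h :: "real \<times> real \<Rightarrow> complex"
  assumes "real_polynomial_function p"
    and "integrable torus h" "\<And>k. (LINT z|torus. h z * fexp k z) = 0"
  shows "integrable torus (\<lambda>z. h z * of_real (p (torus_embed z)))"
    and "(LINT z|torus. h z * of_real (p (torus_embed z)) * fexp k z) = 0"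
proof -
  have *: "integrable torus (\<lambda>z. h z * of_real (p (torus_embed z))) \<and>
    (\<forall>k. (LINT z|torus. h z * of_real (p (torus_embed z)) * fexp k z) = 0)"
    using assms
  proof (induction p arbitrary: h rule: real_polynomial_function.induct)
    case (linear f)
    obtain A B where AB: "\<And>z. complex_of_real (f (torus_embed z)) =
        A * fexp (1, 0) z + cnj A * fexp (- 1, 0) z + B * fexp (0, 1) z + cnj B * fexp (0, - 1) z"
      using bounded_linear_torus_embed[OF linear(1)] by metis
    have eq: "h z * of_real (f (torus_embed z)) * fexp k z =
      A * (h z * fexp ((1, 0) + k) z) + cnj A * (h z * fexp ((- 1, 0) + k) z)
      + B * (h z * fexp ((0, 1) + k) z) + cnj B * (h z * fexp ((0, - 1) + k) z)" for k z
      unfolding fexp_add AB by (simp add: algebra_simps)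
    have int: "integrable torus (\<lambda>z. c * (h z * fexp k z))" for c k
      using integrable_mult_fexp[OF linear(2)] by simp
    have "(LINT z|torus. h z * of_real (f (torus_embed z)) * fexp k z) = 0" for k
      unfolding eq using int linear(3) by simp
    moreover have "integrable torus (\<lambda>z. h z * of_real (f (torus_embed z)))"
      using eq[where k = 0] int by simp
    ultimately show ?case by blast
  next
    case (const c)
    have "(LINT z|torus. h z * of_real c * fexp k z) = of_real c * (LINT z|torus. h z * fexp k z)" for k
      by (subst integral_mult_right_zero[symmetric]) (simp add: mult_ac)
    then show ?case
      using const by simp
  next
    case (add f g)
    from add.IH(1)[OF add.prems] add.IH(2)[OF add.prems] show ?case
      by (simp add: distrib_left distrib_right integrable_mult_fexp)
  next
    case (mult f g)
    note f = mult.IH(1)[OF mult.prems]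
    note g = mult.IH(2)[OF conjunct1[OF f] spec[OF conjunct2[OF f]]]
    show ?case
      using g unfolding of_real_mult mult.assoc .
  qed
  then show "integrable torus (\<lambda>z. h z * of_real (p (torus_embed z)))"
    by (rule conjunct1)
  show "(LINT z|torus. h z * of_real (p (torus_embed z)) * fexp k z) = 0"
    using conjunct2[OF *] by (rule spec)
qed

text \<open>Polynomials approximate \<open>u\<close> uniformly on the compact image of the
  embedding, and a uniform error d changes the integral by at most d times the L^1 norm of
  \<open>h\<close>.\<close>

lemma integral_continuous_torus:
  fixes h :: "real \<times> real \<Rightarrow> complex"
  assumes h: "integrable torus h" and orth: "\<And>k. (LINT z|torus. h z * fexp k z) = 0"
    and u: "continuous_on UNIV u"
  shows "(LINT z|torus. h z * of_real (u (torus_embed z))) = 0"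
    and "integrable torus (\<lambda>z. h z * of_real (u (torus_embed z)))"
proof -
  let ?K = "sphere 0 1 \<times> sphere 0 1 :: (complex \<times> complex) set"
  have K: "compact ?K"
    by (intro compact_Times) auto
  have uK: "continuous_on ?K u"
    using u continuous_on_subset by blast
  have "bounded (u ` ?K)"
    using K uK by (intro compact_imp_bounded compact_continuous_image)
  then obtain C where C: "\<And>w. w \<in> ?K \<Longrightarrow> \<bar>u w\<bar> \<le> C"
    by (force simp: bounded_iff)
  have "continuous_on UNIV (\<lambda>z. u (torus_embed z))"
    by (rule continuous_on_compose2[OF u continuous_torus_embed]) auto
  then have m: "(\<lambda>z. u (torus_embed z)) \<in> borel_measurable torus"
    by (rule measurable_torus_continuous)
  show int: "integrable torus (\<lambda>z. h z * of_real (u (torus_embed z)))"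
    using m C[OF torus_embed_in] by (intro integrable_mult_bounded[OF h, where C = C]) auto
  let ?I = "LINT z|torus. cmod (h z)"
  have "cmod (LINT z|torus. h z * of_real (u (torus_embed z))) \<le> 0 + e" if e: "e > 0" for e
  proof -
    \<comment> \<open>The added 1 keeps the denominator positive when \<open>h\<close> vanishes
      almost everywhere.\<close>
    define d where "d = e / (?I + 1)"
    have I: "?I \<ge> 0" by simp
    have d: "d > 0"
      unfolding d_def by (intro divide_pos_pos add_nonneg_pos I e) auto
    have dI: "e / (x + 1) * x \<le> e" if "x \<ge> 0" for x
      using that e by (simp add: field_simps)
    obtain p where p: "real_polynomial_function p" "\<And>w. w \<in> ?K \<Longrightarrow> \<bar>u w - p w\<bar> < d"
      using Stone_Weierstrass_real_polynomial_function[OF K uK d] by metis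
    have pint: "integrable torus (\<lambda>z. h z * of_real (p (torus_embed z)))"
      "(LINT z|torus. h z * of_real (p (torus_embed z))) = 0"
      using integral_polynomial_torus(1)[OF p(1) h orth] integral_polynomial_torus(2)[OF p(1) h orth, where k = 0]
      by simp_all
    have "(LINT z|torus. h z * of_real (u (torus_embed z))) =
        (LINT z|torus. h z * of_real (u (torus_embed z)) - h z * of_real (p (torus_embed z)))"
      using int pint by (subst Bochner_Integration.integral_diff) auto
    also have "cmod \<dots> \<le> (LINT z|torus. cmod (h z * of_real (u (torus_embed z)) - h z * of_real (p (torus_embed z))))"
      by (rule integral_norm_bound)
    also have "\<dots> \<le> (LINT z|torus. d * cmod (h z))"
    proof (rule integral_mono)
      fix z
      have "cmod (h z * of_real (u (torus_embed z)) - h z * of_real (p (torus_embed z))) =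
          cmod (h z) * \<bar>u (torus_embed z) - p (torus_embed z)\<bar>"
        by (metis norm_mult norm_of_real of_real_diff right_diff_distrib)
      also have "\<dots> \<le> cmod (h z) * d"
        by (intro mult_left_mono less_imp_le[OF p(2)] torus_embed_in) auto
      finally show "cmod (h z * of_real (u (torus_embed z)) - h z * of_real (p (torus_embed z))) \<le> d * cmod (h z)"
        by (simp add: mult.commute)
    qed (use int pint h in auto)
    also have "\<dots> = d * ?I"
      by simp
    also have "\<dots> \<le> e"
      unfolding d_def by (rule dI[OF I])
    finally show ?thesis by simp
  qed
  then have "cmod (LINT z|torus. h z * of_real (u (torus_embed z))) \<le> 0"
    by (rule field_le_epsilon)
  then show "(LINT z|torus. h z * of_real (u (torus_embed z))) = 0"
    by simp
qed

text \<open>Since the embedding is injective on the half-open domain, a compact subset \<open>T\<close> of the domain is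
  the preimage of a closed set, so its indicator is a limit of continuous functions on the torus.\<close>

lemma integral_compact_torus:
  fixes h :: "real \<times> real \<Rightarrow> complex"
  assumes h: "integrable torus h" and orth: "\<And>k. (LINT z|torus. h z * fexp k z) = 0"
    and T: "compact T" "T \<subseteq> space torus"
  shows "(LINT z|torus. h z * indicator T z) = 0"
proof (cases "T = {}")
  case False
  let ?C = "torus_embed ` T"
  have C: "closed ?C" "?C \<noteq> {}"
    using T False by (auto intro!: compact_imp_closed compact_continuous_image continuous_torus_embed)
  \<comment> \<open>Continuous cutoffs equal to 1 on the image of \<open>T\<close> and to 0 beyond
    distance 1/n from it; they decrease to its indicator.\<close>
  define u where "u = (\<lambda>n::nat. \<lambda>w. max 0 (1 - real n * infdist w ?C))"
  have cont: "continuous_on UNIV (u n)" for n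
    unfolding u_def by (intro continuous_intros)
  have u01: "0 \<le> u n w" "u n w \<le> 1" for n w
    by (auto simp: u_def infdist_nonneg)
  have Tb: "T \<in> sets borel"
    using T by (simp add: borel_compact)
  then have mT: "(indicator T :: _ \<Rightarrow> complex) \<in> borel_measurable torus"
    by (intro measurable_torus_borel) auto
  have "(\<lambda>n. LINT z|torus. h z * of_real (u n (torus_embed z))) \<longlonglongrightarrow> (LINT z|torus. h z * indicator T z)"
  proof (rule integral_dominated_convergence[where w = "\<lambda>z. cmod (h z)"])
    show "(\<lambda>z. h z * indicator T z) \<in> borel_measurable torus"
      using h mT by (intro borel_measurable_times) auto
    show "(\<lambda>z. h z * of_real (u n (torus_embed z))) \<in> borel_measurable torus" for n
      using integral_continuous_torus(2)[OF h orth cont] by auto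
    show "integrable torus (\<lambda>z. cmod (h z))"
      using h by simp
    show "AE z in torus. cmod (h z * of_real (u n (torus_embed z))) \<le> cmod (h z)" for n
      by (rule AE_I2) (auto simp: norm_mult u01 intro!: mult_left_le)
    show "AE z in torus. (\<lambda>n. h z * of_real (u n (torus_embed z))) \<longlonglongrightarrow> h z * indicator T z"
    proof (rule AE_I2)
      fix z assume z: "z \<in> space torus"
      have "(\<lambda>n. u n (torus_embed z)) \<longlonglongrightarrow> indicator T z"
      proof (cases "z \<in> T")
        case True
        then show ?thesis by (simp add: u_def)
      next
        case False
        then have "torus_embed z \<notin> ?C"
          using z T inj_on_torus_embed by (metis inj_on_image_mem_iff)
        then have pos: "infdist (torus_embed z) ?C > 0"
          using C by (metis in_closed_iff_infdist_zero infdist_nonneg less_eq_real_def)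
        obtain N :: nat where N: "1 / infdist (torus_embed z) ?C < N"
          using reals_Archimedean2 by blast
        have "u n (torus_embed z) = 0" if "n \<ge> N" for n
        proof -
          have "1 < real N * infdist (torus_embed z) ?C"
            using N pos by (simp add: field_simps)
          also have "\<dots> \<le> real n * infdist (torus_embed z) ?C"
            using that pos by (intro mult_right_mono) auto
          finally show ?thesis by (simp add: u_def)
        qed
        then have "eventually (\<lambda>n. u n (torus_embed z) = 0) sequentially"
          by (auto simp: eventually_sequentially)
        then show ?thesis
          using False by (simp add: tendsto_eventually)
      qed
      then have "(\<lambda>n. h z * complex_of_real (u n (torus_embed z))) \<longlonglongrightarrow> h z * of_real (indicator T z)"
        by (intro tendsto_intros)
      then show "(\<lambda>n. h z * of_real (u n (torus_embed z))) \<longlonglongrightarrow> h z * indicator T z"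
        by (simp add: of_real_indicator)
    qed
  qed
  then show ?thesis
    using integral_continuous_torus(1)[OF h orth cont] by (simp add: LIMSEQ_const_iff)
qed simp

text \<open>By inner regularity the set where \<open>r\<close> is positive contains a compact set
  missing arbitrarily little of it. On that compact set \<open>r\<close> is positive with zero
  integral, so the compact set is null, and hence so is the whole set.\<close>

lemma AE_nonpos_torus:
  fixes r :: "real \<times> real \<Rightarrow> real"
  assumes r: "integrable torus r"
    and zero: "\<And>T. compact T \<Longrightarrow> T \<subseteq> space torus \<Longrightarrow> (LINT z|torus. r z * indicator T z) = 0"
  shows "AE z in torus. r z \<le> 0"
proof -
  define A where "A = {z \<in> space torus. 0 < r z}"
  have A: "A \<in> sets torus"
    unfolding A_def using r by measurable
  have AL: "A \<in> sets lebesgue"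
    using A torus_domain_lebesgue unfolding torus_def by (subst (asm) sets_restrict_space_iff) auto
  have em: "emeasure torus B = emeasure lebesgue B" if "B \<subseteq> space torus" for B
    using that unfolding space_torus unfolding torus_def
    by (intro emeasure_restrict_space) (auto simp: torus_domain_lebesgue)
  have "emeasure torus A \<le> 0 + ennreal e" if e: "e > 0" for e
  proof -
    obtain T where T: "closed T" "T \<subseteq> A" "A - T \<in> lmeasurable" "emeasure lebesgue (A - T) < ennreal e"
      using sets_lebesgue_inner_closed[OF AL e] by metis
    have Ts: "T \<subseteq> space torus"
      using T by (auto simp: A_def)
    have "bounded (space torus)"
      unfolding space_torus by (intro bounded_Times) auto
    then have Tc: "compact T"
      using T Ts bounded_subset compact_eq_bounded_closed by blast
    have Tm: "T \<in> sets torus"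
      using T Ts unfolding space_torus unfolding torus_def
      by (subst sets_restrict_space_iff) (auto simp: torus_domain_lebesgue)
    have "AE z in torus. r z * indicator T z = 0"
    proof (subst integral_nonneg_eq_0_iff_AE[symmetric])
      show "integrable torus (\<lambda>z. r z * indicator T z)"
        using r Tm by (rule integrable_real_mult_indicator[rotated])
      show "AE z in torus. 0 \<le> r z * indicator T z"
        using T by (intro AE_I2) (auto simp: A_def indicator_def)
    qed (rule zero[OF Tc Ts])
    moreover have pos: "r z \<noteq> 0" if "z \<in> T" for z
      using that T(2) by (auto simp: A_def)
    ultimately have "AE z in torus. z \<notin> T"
      by (auto elim!: eventually_mono)
    moreover have "{z \<in> space torus. \<not> z \<notin> T} = T"
      using Ts by blast
    ultimately have "T \<in> null_sets torus"
      using Tm AE_iff_measurable[of T torus "\<lambda>z. z \<notin> T"] by (simp add: null_setsI)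
    then have "emeasure torus A = emeasure torus (A - T)"
      using A by (simp add: emeasure_Diff_null_set)
    also have "\<dots> = emeasure lebesgue (A - T)"
      by (rule em) (auto simp: A_def)
    also have "\<dots> \<le> ennreal e"
      using T(4) by (rule less_imp_le)
    finally show ?thesis by simp
  qed
  then have "emeasure torus A \<le> 0"
    by (rule ennreal_le_epsilon) auto
  then show ?thesis
    using AE_iff_measurable[OF A, of "\<lambda>z. r z \<le> 0"] by (simp add: A_def not_le)
qed

text \<open>Vanishing integrals over compact sets give a sign statement for real functions, so it is
  applied to the real and the imaginary part with both signs.\<close>

theorem fourier_uniqueness:
  fixes h :: "real \<times> real \<Rightarrow> complex"
  assumes h: "integrable torus h" and orth: "\<And>k. (LINT z|torus. h z * fexp k z) = 0"
  shows "AE z in torus. h z = 0"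
proof -
  note zero = integral_compact_torus[OF h orth]
  have int: "integrable torus (\<lambda>z. h z * indicator T z)" if "compact T" for T
    using that
    by (intro integrable_mult_bounded[OF h, where C = 1] measurable_torus_borel borel_measurable_indicator)
      (auto simp: borel_compact indicator_def)
  have Re: "(LINT z|torus. Re (h z) * indicator T z) = 0"
    and Im: "(LINT z|torus. Im (h z) * indicator T z) = 0" if T: "compact T" "T \<subseteq> space torus" for T
  proof -
    have "(LINT z|torus. Re (h z) * indicator T z) = (LINT z|torus. Re (h z * indicator T z))"
      "(LINT z|torus. Im (h z) * indicator T z) = (LINT z|torus. Im (h z * indicator T z))"
      by (intro Bochner_Integration.integral_cong; simp add: indicator_def)+
    moreover have "(LINT z|torus. Re (h z * indicator T z)) = 0" "(LINT z|torus. Im (h z * indicator T z)) = 0"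
      using integral_Re[OF int[OF T(1)]] integral_Im[OF int[OF T(1)]] zero[OF T] by simp_all
    ultimately show "(LINT z|torus. Re (h z) * indicator T z) = 0" "(LINT z|torus. Im (h z) * indicator T z) = 0"
      by simp_all
  qed
  have vanish: "AE z in torus. r z = 0"
    if r: "integrable torus r" and "\<And>T. compact T \<Longrightarrow> T \<subseteq> space torus \<Longrightarrow> (LINT z|torus. r z * indicator T z) = 0"
    for r :: "real \<times> real \<Rightarrow> real"
  proof -
    have "AE z in torus. r z \<le> 0"
      using that by (rule AE_nonpos_torus)
    moreover have "AE z in torus. - r z \<le> 0"
    proof (rule AE_nonpos_torus)
      show "integrable torus (\<lambda>z. - r z)"
        using r by simp
      show "(LINT z|torus. - r z * indicator T z) = 0" if "compact T" "T \<subseteq> space torus" for T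
        using \<open>\<And>T. compact T \<Longrightarrow> T \<subseteq> space torus \<Longrightarrow> (LINT z|torus. r z * indicator T z) = 0\<close>[OF that]
        by simp
    qed
    ultimately show ?thesis
      by eventually_elim simp
  qed
  have "AE z in torus. Re (h z) = 0"
    using h by (intro vanish Re) simp_all
  moreover have "AE z in torus. Im (h z) = 0"
    using h by (intro vanish Im) simp_all
  ultimately show ?thesis
    by eventually_elim (simp add: complex_eq_iff)
qed

section \<open>Fourier series and products\<close>

lemma fourier_coeff_fexp:
  "fourier_coeff f k = (LINT z|torus. complex_of_real (f z) * fexp (- k) z) / complex_of_real (4 * pi\<^sup>2)"
proof -
  obtain m n where k: "k = (m, n)" by fastforce
  have "(LINT z|torus. complex_of_real (f z) * fexp (- k) z) =
      (LINT (x, y)|torus. complex_of_real (f (x, y)) * cis (- (of_int m * x + of_int n * y)))"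
    by (intro Bochner_Integration.integral_cong) (auto simp: fexp_def k)
  then show ?thesis
    by (simp add: fourier_coeff_def k)
qed

section \<open>Square integrable functions and linearity of their coefficients\<close>

lemma integrable_L2_mult:
  assumes "f \<in> L2" "g \<in> L2"
  shows "integrable torus (\<lambda>z. f z * g z)"
proof (rule Bochner_Integration.integrable_bound[where f = "\<lambda>z. (f z)\<^sup>2 + (g z)\<^sup>2"])
  show "integrable torus (\<lambda>z. (f z)\<^sup>2 + (g z)\<^sup>2)"
    using assms by (auto simp: L2_def)
  show "(\<lambda>z. f z * g z) \<in> borel_measurable torus"
    using assms by (auto simp: L2_def)
  have "\<bar>a * b\<bar> \<le> a\<^sup>2 + b\<^sup>2" for a b :: real
    using sum_squares_bound[of "\<bar>a\<bar>" "\<bar>b\<bar>"] abs_ge_zero[of "a * b"]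
    unfolding abs_mult by (simp only: power2_abs)
  then show "AE z in torus. norm (f z * g z) \<le> norm ((f z)\<^sup>2 + (g z)\<^sup>2)"
    by (intro AE_I2) simp
qed

lemma L2_continuous:
  assumes "periodic2 f" "continuous_on UNIV f" "\<And>z. \<bar>f z\<bar> \<le> C"
  shows "f \<in> L2"
proof -
  have m: "f \<in> borel_measurable torus"
    using assms(2) by (rule measurable_torus_continuous)
  have "(f z)\<^sup>2 \<le> C\<^sup>2" for z
    using assms(3)[of z] by (metis abs_ge_zero power2_abs power_mono)
  then have "integrable torus (\<lambda>z. (f z)\<^sup>2)"
    using m by (intro torus.integrable_const_bound[where B = "C\<^sup>2"] AE_I2) auto
  then show ?thesis
    using assms(1) m by (simp add: L2_def)
qed

lemma integrable_L2: "f \<in> L2 \<Longrightarrow> integrable torus f"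
  using integrable_L2_mult[of f "\<lambda>_. 1"] L2_continuous[of "\<lambda>_. 1" 1]
  by (simp add: periodic2_def)

lemma L2_scale: "f \<in> L2 \<Longrightarrow> (\<lambda>z. c * f z) \<in> L2"
  by (auto simp: L2_def periodic2_def power_mult_distrib)

lemma L2_add: "f \<in> L2 \<Longrightarrow> g \<in> L2 \<Longrightarrow> (\<lambda>z. f z + g z) \<in> L2"
  using integrable_L2_mult[of f g]
  by (auto simp: L2_def periodic2_def power2_sum mult.assoc)

lemma L2_diff: "f \<in> L2 \<Longrightarrow> g \<in> L2 \<Longrightarrow> (\<lambda>z. f z - g z) \<in> L2"
  using L2_add[of f "\<lambda>z. - 1 * g z"] L2_scale[of g "- 1"] by simp

lemma integrable_fourier:
  "integrable torus f \<Longrightarrow> integrable torus (\<lambda>z. complex_of_real (f z) * fexp k z)"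
  by (intro integrable_mult_fexp) simp

lemma fourier_coeff_add:
  "f \<in> L2 \<Longrightarrow> g \<in> L2 \<Longrightarrow> fourier_coeff (\<lambda>z. f z + g z) k = fourier_coeff f k + fourier_coeff g k"
  using integrable_fourier[OF integrable_L2]
  by (simp add: fourier_coeff_fexp distrib_right add_divide_distrib)

lemma fourier_coeff_scale:
  "fourier_coeff (\<lambda>z. c * f z) k = of_real c * fourier_coeff f k"
  by (simp add: fourier_coeff_fexp mult.assoc)

lemma fourier_coeff_diff:
  assumes "f \<in> L2" "g \<in> L2"
  shows "fourier_coeff (\<lambda>z. f z - g z) k = fourier_coeff f k - fourier_coeff g k"
  using fourier_coeff_add[OF assms(1) L2_scale[OF assms(2)], of "- 1" k]
    fourier_coeff_scale[of "- 1" g k] by simp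

text \<open>Termwise integration, the common source of the inversion formula (\<open>h\<close> a
  character) and of the convolution formula (\<open>h\<close> a function times a character). Since
  characters have modulus 1, the norms of the terms integrate to a convergent series.\<close>

lemma integral_fourier_series:
  fixes h :: "real \<times> real \<Rightarrow> complex" and d :: "int \<times> int \<Rightarrow> complex"
  assumes h: "integrable torus h" and d: "(\<lambda>j. norm (d j)) summable_on UNIV"
  shows "integrable torus (\<lambda>z. h z * (\<Sum>\<^sub>\<infinity>j. d j * fexp j z))"
    and "((\<lambda>j. d j * (LINT z|torus. h z * fexp j z)) has_sum
      (LINT z|torus. h z * (\<Sum>\<^sub>\<infinity>j. d j * fexp j z))) UNIV"
proof -
  \<comment> \<open>Interchange of sum and integral is stated for sequences; an enumeration of the
    frequencies converts between the two kinds of sums.\<close>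
  obtain b :: "nat \<Rightarrow> int \<times> int" where b: "bij_betw b UNIV UNIV"
    using bij_betw_from_nat_into[of "UNIV :: (int \<times> int) set"] infinite_UNIV_char_0
    by (auto simp: finite_prod)
  have sd: "summable (\<lambda>n. norm (d (b n)))"
    using d summable_on_reindex_bij_betw[OF b, of "\<lambda>j. norm (d j)"] by (auto intro: summable_on_imp_summable)
  have "(\<lambda>n. d (b n) * fexp (b n) z) sums (\<Sum>\<^sub>\<infinity>j. d j * fexp j z)" for z
  proof -
    have "(\<lambda>j. norm (d j * fexp j z)) summable_on UNIV"
      using d by (simp add: norm_mult)
    then have "(\<lambda>j. d j * fexp j z) summable_on UNIV"
      by (rule abs_summable_summable)
    then have "((\<lambda>j. d j * fexp j z) has_sum (\<Sum>\<^sub>\<infinity>j. d j * fexp j z)) UNIV"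
      by (rule has_sum_infsum)
    then have "((\<lambda>n. d (b n) * fexp (b n) z) has_sum (\<Sum>\<^sub>\<infinity>j. d j * fexp j z)) UNIV"
      by (subst has_sum_reindex_bij_betw[OF b])
    then show ?thesis
      by (rule has_sum_imp_sums)
  qed
  then have S: "(\<lambda>n. h z * (d (b n) * fexp (b n) z)) sums (h z * (\<Sum>\<^sub>\<infinity>j. d j * fexp j z))" for z
    by (intro sums_mult)
  have int: "integrable torus (\<lambda>z. h z * (d (b n) * fexp (b n) z))" for n
  proof -
    have "integrable torus (\<lambda>z. d (b n) * (h z * fexp (b n) z))"
      by (intro integrable_mult_right integrable_mult_fexp h)
    then show ?thesis
      by (simp only: mult.left_commute)
  qed
  have AE: "AE z in torus. summable (\<lambda>n. norm (h z * (d (b n) * fexp (b n) z)))"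
    using sd by (intro AE_I2) (simp add: norm_mult summable_mult)
  have eq: "(LINT z|torus. norm (h z * (d (b n) * fexp (b n) z))) = norm (d (b n)) * (LINT z|torus. norm (h z))" for n
    by (subst integral_mult_right_zero[symmetric]) (simp add: norm_mult mult_ac)
  have s: "summable (\<lambda>n. LINT z|torus. norm (h z * (d (b n) * fexp (b n) z)))"
    unfolding eq using sd by (rule summable_mult2)
  have suminf: "(\<Sum>n. h z * (d (b n) * fexp (b n) z)) = h z * (\<Sum>\<^sub>\<infinity>j. d j * fexp j z)" for z
    by (rule sums_unique[OF S, symmetric])
  show "integrable torus (\<lambda>z. h z * (\<Sum>\<^sub>\<infinity>j. d j * fexp j z))"
    using integrable_suminf[OF int AE s] unfolding suminf .
  let ?c = "\<lambda>j. d j * (LINT z|torus. h z * fexp j z)"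
  have ceq: "(LINT z|torus. h z * (d (b n) * fexp (b n) z)) = ?c (b n)" for n
    by (subst integral_mult_right_zero[symmetric]) (simp add: mult_ac)
  have "(\<lambda>n. ?c (b n)) sums (LINT z|torus. h z * (\<Sum>\<^sub>\<infinity>j. d j * fexp j z))"
    using sums_integral[OF int AE s] unfolding suminf ceq .
  moreover have "summable (\<lambda>n. norm (?c (b n)))"
  proof (rule summable_comparison_test')
    show "summable (\<lambda>n. norm (d (b n)) * (LINT z|torus. norm (h z)))"
      using sd by (rule summable_mult2)
    fix n
    have "norm (LINT z|torus. h z * fexp (b n) z) \<le> (LINT z|torus. norm (h z * fexp (b n) z))"
      by (rule integral_norm_bound)
    then show "norm (norm (?c (b n))) \<le> norm (d (b n)) * (LINT z|torus. norm (h z))"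
      by (simp add: norm_mult mult_left_mono)
  qed
  ultimately have "((\<lambda>n. ?c (b n)) has_sum (LINT z|torus. h z * (\<Sum>\<^sub>\<infinity>j. d j * fexp j z))) UNIV"
    by (rule norm_summable_imp_has_sum[rotated])
  then show "(?c has_sum (LINT z|torus. h z * (\<Sum>\<^sub>\<infinity>j. d j * fexp j z))) UNIV"
    by (subst (asm) has_sum_reindex_bij_betw[OF b])
qed

lemma has_sum_single:
  fixes f :: "'a \<Rightarrow> 'b::{comm_monoid_add, t2_space}"
  assumes "\<And>j. j \<noteq> i \<Longrightarrow> f j = 0"
  shows "(f has_sum f i) UNIV"
  using assms has_sum_finite[of "{i}" f] by (subst has_sum_cong_neutral[of "{i}" UNIV f f]) auto

text \<open>By orthogonality the series has the same Fourier coefficients as \<open>f\<close>, so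
  uniqueness applies to the difference.\<close>

lemma fourier_series:
  assumes f: "f \<in> L2" and s: "(\<lambda>j. norm (fourier_coeff f j)) summable_on UNIV"
  shows "AE z in torus. complex_of_real (f z) = (\<Sum>\<^sub>\<infinity>j. fourier_coeff f j * fexp j z)"
proof -
  let ?S = "\<lambda>z. \<Sum>\<^sub>\<infinity>j. fourier_coeff f j * fexp j z"
  have one: "integrable torus (\<lambda>_. 1 :: complex)"
    by (rule integrable_torus_bounded[where C = 1]) auto
  have e: "integrable torus (fexp k)" for k
    by (rule integrable_torus_bounded[where C = 1]) auto
  have S: "integrable torus ?S"
    using integral_fourier_series(1)[OF one s] by simp
  have fi: "integrable torus f"
    using f by (rule integrable_L2)
  have "AE z in torus. complex_of_real (f z) - ?S z = 0"
  proof (rule fourier_uniqueness)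
    show "integrable torus (\<lambda>z. complex_of_real (f z) - ?S z)"
      using fi S by simp
    fix k
    let ?c = "\<lambda>j. fourier_coeff f j * (LINT z|torus. fexp k z * fexp j z)"
    have "(?c has_sum (LINT z|torus. fexp k z * ?S z)) UNIV"
      using integral_fourier_series(2)[OF e s] .
    moreover have c: "?c j = (if j = - k then fourier_coeff f j * complex_of_real (4 * pi\<^sup>2) else 0)" for j
      unfolding fexp_add[symmetric] integral_fexp by (auto simp: add_eq_0_iff)
    have "(?c has_sum ?c (- k)) UNIV"
      by (rule has_sum_single) (simp add: c)
    ultimately have "(LINT z|torus. fexp k z * ?S z) = ?c (- k)"
      by (rule has_sum_unique)
    also have "\<dots> = (LINT z|torus. complex_of_real (f z) * fexp k z)"
      unfolding c by (simp add: fourier_coeff_fexp)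
    finally have "(LINT z|torus. ?S z * fexp k z) = (LINT z|torus. complex_of_real (f z) * fexp k z)"
      by (simp add: mult.commute)
    then show "(LINT z|torus. (complex_of_real (f z) - ?S z) * fexp k z) = 0"
      using integrable_fourier[OF fi] integrable_mult_fexp[OF S]
      by (simp add: left_diff_distrib)
  qed
  then show ?thesis by simp
qed

text \<open>The series of \<open>g\<close> is inserted and integrated termwise. The asymmetry is
  deliberate: the derivatives of the vorticity have summable coefficients, while the velocity enters
  merely as an L^2 function.\<close>

lemma fourier_coeff_mult:
  assumes f: "f \<in> L2" and g: "g \<in> L2" and s: "(\<lambda>j. norm (fourier_coeff g j)) summable_on UNIV"
  shows "((\<lambda>j. fourier_coeff g j * fourier_coeff f (k - j)) has_sum fourier_coeff (\<lambda>z. f z * g z) k) UNIV"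
proof -
  let ?S = "\<lambda>z. \<Sum>\<^sub>\<infinity>j. fourier_coeff g j * fexp j z"
  let ?h = "\<lambda>z. complex_of_real (f z) * fexp (- k) z"
  have h: "integrable torus ?h"
    using f by (intro integrable_fourier integrable_L2)
  have S: "((\<lambda>j. fourier_coeff g j * (LINT z|torus. ?h z * fexp j z)) has_sum (LINT z|torus. ?h z * ?S z)) UNIV"
    by (rule integral_fourier_series(2)[OF h s])
  have eq: "(LINT z|torus. ?h z * fexp j z) = fourier_coeff f (k - j) * complex_of_real (4 * pi\<^sup>2)" for j
    using fexp_add[of "- k" j] by (simp add: fourier_coeff_fexp mult.assoc add.commute)
  have "(LINT z|torus. ?h z * ?S z) = (LINT z|torus. complex_of_real (f z * g z) * fexp (- k) z)"
  proof (rule integral_cong_AE)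
    show "(\<lambda>z. ?h z * ?S z) \<in> borel_measurable torus"
      using integral_fourier_series(1)[OF h s] by simp
    have "integrable torus (\<lambda>z. complex_of_real (f z * g z) * fexp (- k) z)"
      using integrable_L2_mult[OF f g] by (rule integrable_fourier)
    then show "(\<lambda>z. complex_of_real (f z * g z) * fexp (- k) z) \<in> borel_measurable torus"
      by simp
    show "AE z in torus. ?h z * ?S z = complex_of_real (f z * g z) * fexp (- k) z"
      using fourier_series[OF g s] by eventually_elim (simp add: mult_ac)
  qed
  then have I: "(LINT z|torus. ?h z * ?S z) = fourier_coeff (\<lambda>z. f z * g z) k * complex_of_real (4 * pi\<^sup>2)"
    by (simp add: fourier_coeff_fexp)
  from S show ?thesis
    unfolding I eq mult.assoc[symmetric] by (simp add: has_sum_cmult_left_iff del: of_real_mult)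
qed

section \<open>Real Fourier modes and the projection onto the kernel\<close>

definition harmonic :: "complex \<Rightarrow> int \<times> int \<Rightarrow> real \<times> real \<Rightarrow> real" where
  "harmonic u k z = Re (u * fexp k z)"

lemma fexp_period: "fexp k (x + 2 * pi, y) = fexp k (x, y)" "fexp k (x, y + 2 * pi) = fexp k (x, y)"
proof -
  have c: "cis (a + of_int m * (2 * pi)) = cis a" for a m
    by (metis cis_mult cis_multiple_2pi Ints_of_int mult.commute mult.right_neutral)
  show "fexp k (x + 2 * pi, y) = fexp k (x, y)" "fexp k (x, y + 2 * pi) = fexp k (x, y)"
    unfolding fexp_def
    using c[of "of_int (fst k) * x + of_int (snd k) * y" "fst k"]
      c[of "of_int (fst k) * x + of_int (snd k) * y" "snd k"]
    by (simp_all add: algebra_simps)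
qed

lemma L2_harmonic: "harmonic u k \<in> L2"
proof (rule L2_continuous)
  show "periodic2 (harmonic u k)"
    by (simp add: periodic2_def harmonic_def fexp_period del: times_complex.sel)
  show "continuous_on UNIV (harmonic u k)"
    unfolding harmonic_def by (intro continuous_intros continuous_fexp)
  show "\<bar>harmonic u k z\<bar> \<le> cmod u" for z
    using abs_Re_le_cmod[of "u * fexp k z"] by (simp add: harmonic_def norm_mult)
qed

text \<open>The two conditionals are added rather than nested because k and -k coincide at k = 0,
  where both contribute and yield Re u.\<close>

lemma fourier_coeff_harmonic:
  "fourier_coeff (harmonic u k) j = (if j = k then u / 2 else 0) + (if j = - k then cnj u / 2 else 0)"
proof -
  have e: "integrable torus (fexp k)" for k
    by (rule integrable_torus_bounded[where C = 1]) auto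
  have "complex_of_real (harmonic u k z) = (u * fexp k z + cnj (u * fexp k z)) / 2" for z
    by (metis harmonic_def complex_add_cnj nonzero_mult_div_cancel_left of_real_divide of_real_mult of_real_numeral zero_neq_numeral)
  then have "complex_of_real (harmonic u k z) * fexp (- j) z =
      u / 2 * fexp (k + - j) z + cnj u / 2 * fexp (- k + - j) z" for z
    unfolding fexp_add by (simp add: cnj_fexp distrib_right add_divide_distrib mult.assoc)
  then have "(LINT z|torus. complex_of_real (harmonic u k z) * fexp (- j) z) =
      u / 2 * (LINT z|torus. fexp (k + - j) z) + cnj u / 2 * (LINT z|torus. fexp (- k + - j) z)"
    using e by simp
  then show ?thesis
    unfolding fourier_coeff_fexp integral_fexp
    by (auto simp: add_divide_distrib)
qed

text \<open>Either m = 0 and the x-derivative vanishes, or |k| = 1, where the inverse Laplacian acts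
  as -1 and \<open>1 + \<Delta>^-1\<close> annihilates the mode. In both cases \<open>?w\<close> is
  the negative of \<open>?g\<close>.\<close>

lemma harmonic_ker_LK:
  assumes "fst k = 0 \<or> (fst k)\<^sup>2 + (snd k)\<^sup>2 = 1"
  shows "harmonic u k \<in> ker_LK"
proof -
  obtain m n where k: "k = (m, n)" by fastforce
  let ?g = "harmonic (\<i> * of_int m * u) k"
  let ?w = "harmonic (- (\<i> * of_int m * u)) k"
  have "is_dx (harmonic u k) ?g"
    by (auto simp: is_dx_def L2_harmonic fourier_coeff_harmonic k)
  moreover have "is_inv_laplacian ?g ?w"
  proof -
    have "(of_int m :: complex) = 0 \<or> (of_int m)\<^sup>2 + (of_int n)\<^sup>2 = (1 :: complex)"
      using assms unfolding k by (metis fst_conv snd_conv of_int_0 of_int_1 of_int_add of_int_power)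
    then have "- ((of_int m')\<^sup>2 + (of_int n')\<^sup>2) * fourier_coeff ?w (m', n') = fourier_coeff ?g (m', n')" for m' n'
    proof
      assume 1: "(of_int m)\<^sup>2 + (of_int n)\<^sup>2 = (1 :: complex)"
      show ?thesis
      proof (cases "(m', n') = k \<or> (m', n') = - k")
        case True
        then have "(of_int m')\<^sup>2 + (of_int n')\<^sup>2 = (1 :: complex)"
          using 1 by (auto simp: k)
        then show ?thesis
          by (simp add: fourier_coeff_harmonic)
      next
        case False
        then show ?thesis
          by (simp add: fourier_coeff_harmonic)
      qed
    qed (simp add: fourier_coeff_harmonic)
    moreover have "fourier_coeff ?w (0, 0) = 0"
      using assms by (auto simp: fourier_coeff_harmonic k)
    ultimately show ?thesis
      unfolding is_inv_laplacian_def by (intro conjI allI L2_harmonic)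
  qed
  moreover have "?g z + ?w z = 0" for z
    by (simp add: harmonic_def)
  moreover have "(\<lambda>_. 0) \<in> L2"
    by (rule L2_continuous[where C = 0]) (auto simp: periodic2_def)
  ultimately show ?thesis
    unfolding ker_LK_def is_LK_def by (intro CollectI conjI exI[of _ ?g] exI[of _ ?w]) auto
qed

text \<open>Since the kernel consists of real functions, the complex coefficient is read off in two
  tests: the phases u = 1 and u = -i at frequency -k give its real and imaginary part up to a
  constant.\<close>

lemma PK_fourier_coeff:
  assumes pk: "is_PK f p" and p: "p \<in> L2"
    and k: "fst k = 0 \<or> (fst k)\<^sup>2 + (snd k)\<^sup>2 = 1"
  shows "fourier_coeff (\<lambda>z. f z - p z) k = 0"
proof -
  have f: "f \<in> L2"
    using pk by (simp add: is_orth_proj_def)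
  have zero: "(LINT z|torus. (f z - p z) * harmonic u (- k) z) = 0" for u
    using pk harmonic_ker_LK[of "- k" u] k by (simp add: is_orth_proj_def)
  let ?h = "\<lambda>z. complex_of_real (f z - p z) * fexp (- k) z"
  have h: "integrable torus ?h"
    using f p by (intro integrable_fourier integrable_L2 L2_diff)
  have "Re (LINT z|torus. ?h z) = (LINT z|torus. (f z - p z) * harmonic 1 (- k) z)"
    by (subst integral_Re[OF h, symmetric]) (simp add: harmonic_def)
  moreover have "Im (LINT z|torus. ?h z) = (LINT z|torus. (f z - p z) * harmonic (- \<i>) (- k) z)"
    by (subst integral_Im[OF h, symmetric]) (simp add: harmonic_def)
  ultimately show ?thesis
    unfolding fourier_coeff_fexp zero by (simp add: complex_eq_iff)
qed

section \<open>The Euler nonlinearity on Fourier coefficients\<close>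

text \<open>The squared Japanese bracket: one factor counts two derivatives, and \<open>wt^6\<close>
  is the weight of the squared H^6 norm.\<close>

definition wt :: "int \<times> int \<Rightarrow> real" where
  "wt k = 1 + (of_int (fst k))\<^sup>2 + (of_int (snd k))\<^sup>2"

lemma wt_ge_1: "1 \<le> wt k"
  by (simp add: wt_def)

lemma wt_pos [simp]: "0 < wt k" and wt_nonneg [simp]: "0 \<le> wt k"
  using wt_ge_1[of k] by simp_all

text \<open>Tonelli after the substitution (k, j) to (j, k - j). For nonnegative terms Young's
  inequality for summable functions becomes an equality.\<close>

lemma summable_convolution:
  fixes f g :: "'a::ab_group_add \<Rightarrow> real"
  assumes f: "f summable_on UNIV" and g: "g summable_on UNIV"
    and f0: "\<And>j. 0 \<le> f j" and g0: "\<And>j. 0 \<le> g j"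
  shows "(\<lambda>j. f j * g (k - j)) summable_on UNIV"
    and "(\<lambda>k. \<Sum>\<^sub>\<infinity>j. f j * g (k - j)) summable_on UNIV"
    and "(\<Sum>\<^sub>\<infinity>k. \<Sum>\<^sub>\<infinity>j. f j * g (k - j)) = infsum f UNIV * infsum g UNIV"
proof -
  have prod: "((\<lambda>(j, d). f j * g d) has_sum infsum f UNIV * infsum g UNIV) (UNIV \<times> UNIV)"
  proof (rule has_sum_SigmaI)
    show "((\<lambda>d. case (j, d) of (j, d) \<Rightarrow> f j * g d) has_sum f j * infsum g UNIV) UNIV" for j
      using has_sum_cmult_right[OF has_sum_infsum[OF g], of "f j"] by simp
    show "((\<lambda>j. f j * infsum g UNIV) has_sum infsum f UNIV * infsum g UNIV) UNIV"
      by (rule has_sum_cmult_left[OF has_sum_infsum[OF f]])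
    show "(\<lambda>(j, d). f j * g d) summable_on UNIV \<times> UNIV"
    proof (rule summable_on_SigmaI[where g = "\<lambda>j. f j * infsum g UNIV"])
      show "((\<lambda>d. case (j, d) of (j, d) \<Rightarrow> f j * g d) has_sum f j * infsum g UNIV) UNIV" for j
        using has_sum_cmult_right[OF has_sum_infsum[OF g], of "f j"] by simp
      show "(\<lambda>j. f j * infsum g UNIV) summable_on UNIV"
        using f by (rule summable_on_cmult_left)
    qed (auto simp: f0 g0)
  qed
  have "((\<lambda>(k, j). f j * g (k - j)) has_sum infsum f UNIV * infsum g UNIV) (UNIV \<times> UNIV)"
    using prod
    by (subst has_sum_reindex_bij_witness[where i = "\<lambda>(j, d). (j + d, j)" and j = "\<lambda>(k, j). (j, k - j)"
          and h = "\<lambda>(j, d). f j * g d" and T = "UNIV \<times> UNIV"]) auto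
  then have *: "(\<lambda>(k, j). f j * g (k - j)) summable_on UNIV \<times> UNIV"
    "infsum (\<lambda>(k, j). f j * g (k - j)) (UNIV \<times> UNIV) = infsum f UNIV * infsum g UNIV"
    by (auto simp: summable_on_def infsumI)
  show "(\<lambda>k. \<Sum>\<^sub>\<infinity>j. f j * g (k - j)) summable_on UNIV"
    using summable_on_Sigma_banach[OF *(1)] .
  show "(\<Sum>\<^sub>\<infinity>k. \<Sum>\<^sub>\<infinity>j. f j * g (k - j)) = infsum f UNIV * infsum g UNIV"
    using infsum_Sigma'_banach[OF *(1)] *(2) by simp
  show "(\<lambda>j. f j * g (k - j)) summable_on UNIV"
    using summable_on_SigmaD1[of "\<lambda>k j. f j * g (k - j)" UNIV "\<lambda>_. UNIV" k] *(1) f0 g0 by auto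
qed

text \<open>The Fourier multiplier of \<open>(f, g) \<mapsto> \<nabla>\<^sup>\<bottom>\<Delta>\<^sup>-\<^sup>1 f \<cdot> \<nabla>g\<close>; division by zero makes it vanish at
  \<open>j = 0\<close>.\<close>

definition euler_kernel :: "int \<times> int \<Rightarrow> int \<times> int \<Rightarrow> real" where
  "euler_kernel j k = of_int (fst j * snd k - snd j * fst k) / of_int ((fst j)\<^sup>2 + (snd j)\<^sup>2)"

definition euler_form :: "(int \<times> int \<Rightarrow> complex) \<Rightarrow> (int \<times> int \<Rightarrow> complex) \<Rightarrow> int \<times> int \<Rightarrow> complex" where
  "euler_form f g k = (\<Sum>\<^sub>\<infinity>j. of_real (euler_kernel j k) * f j * g (k - j))"

text \<open>The numerator is the cross product of j with k, equivalently of j with k - j, hence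
  linear in j, against a denominator quadratic in j. This spare power pays for the part snd j of snd
  k = snd j + snd (k - j); the other part falls on the second argument. So an additional
  y-derivative of N only doubles the bound.\<close>

lemma euler_kernel_bounds:
  "\<bar>euler_kernel j k\<bar> \<le> wt (k - j)"
  "\<bar>of_int (snd k)\<bar> * \<bar>euler_kernel j k\<bar> \<le> 2 * wt (k - j)"
proof -
  obtain a b where j: "j = (a, b)" by fastforce
  obtain c e where d: "k - j = (c, e)" by fastforce
  have k: "k = (a + c, b + e)"
    using j d by (metis add.commute add_Pair diff_add_cancel)
  let ?a = "of_int \<bar>a\<bar> :: real" and ?b = "of_int \<bar>b\<bar> :: real"
    and ?c = "of_int \<bar>c\<bar> :: real" and ?e = "of_int \<bar>e\<bar> :: real"
  let ?q = "?a\<^sup>2 + ?b\<^sup>2"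
  let ?K = "\<bar>euler_kernel j k\<bar>"
  have K: "?K = \<bar>of_int (a * e - b * c)\<bar> / ?q"
    by (simp add: euler_kernel_def j k abs_divide algebra_simps)
  have num: "\<bar>of_int (a * e - b * c)\<bar> \<le> ?a * ?e + ?b * ?c"
    using abs_triangle_ineq4[of "of_int (a * e)" "of_int (b * c) :: real"] by (simp add: abs_mult)
  have wt: "wt (k - j) = 1 + ?c\<^sup>2 + ?e\<^sup>2"
    by (simp add: wt_def d)
  \<comment> \<open>True because a and b are integers: the smallest nonzero frequency is 1.\<close>
  have sq: "?a \<le> ?a\<^sup>2" "?b \<le> ?b\<^sup>2"
    using int_one_le_iff_zero_less zero_le_power2
    by (metis abs_ge_zero abs_of_nonneg of_int_le_iff of_int_power self_le_power zero_less_numeral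
        order_le_less power_zero_numeral zless_imp_add1_zle add_0)+
  have ce: "?c \<le> (1 + ?c\<^sup>2) / 2" "?e \<le> (1 + ?e\<^sup>2) / 2" "?c * ?e \<le> (?c\<^sup>2 + ?e\<^sup>2) / 2" "?a * ?b \<le> ?q / 2"
    using sum_squares_bound[of 1 ?c] sum_squares_bound[of 1 ?e] sum_squares_bound[of ?c ?e]
      sum_squares_bound[of ?a ?b] by simp_all
  \<comment> \<open>At j = 0 the denominator is 0 and the quotient is 0 by convention; the
    assumption 0 <= y covers this case.\<close>
  have div: "x / ?q \<le> y" if "x \<le> y * ?q" "0 \<le> y" for x y
  proof -
    have "x / ?q \<le> y * ?q / ?q"
      using that by (intro divide_right_mono) auto
    also have "\<dots> \<le> y"
      using that by (cases "?q = 0") auto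
    finally show ?thesis .
  qed
  have arith: "x + y \<le> 1 + x\<^sup>2 + y\<^sup>2" "(y / 2 + x) + y * (x + y) \<le> 2 * (1 + x\<^sup>2 + y\<^sup>2)"
    if *: "x \<le> (1 + x\<^sup>2) / 2" "y \<le> (1 + y\<^sup>2) / 2" "x * y \<le> (x\<^sup>2 + y\<^sup>2) / 2" for x y :: real
  proof -
    have yx: "y * (x + y) = x * y + y\<^sup>2"
      by (simp add: algebra_simps power2_eq_square)
    have sq: "0 \<le> x\<^sup>2" "0 \<le> y\<^sup>2"
      by simp_all
    show "x + y \<le> 1 + x\<^sup>2 + y\<^sup>2"
      using * sq by argo
    show "(y / 2 + x) + y * (x + y) \<le> 2 * (1 + x\<^sup>2 + y\<^sup>2)"
      unfolding yx using * sq by argo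
  qed
  have KK: "?K \<le> ?c + ?e"
    unfolding K
  proof (rule div)
    have "?a * ?e \<le> ?q * ?e" "?b * ?c \<le> ?q * ?c"
      using sq by (auto intro!: mult_right_mono simp: add_increasing add_increasing2)
    then show "\<bar>of_int (a * e - b * c)\<bar> \<le> (?c + ?e) * ?q"
      using num by (simp add: algebra_simps)
  qed simp
  also have "\<dots> \<le> wt (k - j)"
    unfolding wt using ce by (intro arith)
  finally show "?K \<le> wt (k - j)" .
  have bK: "?b * ?K \<le> ?e / 2 + ?c"
  proof -
    have "?b * \<bar>of_int (a * e - b * c)\<bar> \<le> ?b * (?a * ?e + ?b * ?c)"
      using num by (intro mult_left_mono) auto
    also have "\<dots> = (?a * ?b) * ?e + ?b\<^sup>2 * ?c"
      by (simp add: algebra_simps power2_eq_square)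
    also have "\<dots> \<le> (?q / 2) * ?e + ?q * ?c"
      using ce by (intro add_mono mult_right_mono) auto
    also have "\<dots> = (?e / 2 + ?c) * ?q"
      by (simp add: algebra_simps)
    finally show ?thesis
      unfolding K times_divide_eq_right by (intro div) auto
  qed
  have "\<bar>of_int (snd k)\<bar> * ?K \<le> (?b + ?e) * ?K"
    by (intro mult_right_mono) (auto simp: k)
  also have "\<dots> \<le> (?e / 2 + ?c) + ?e * (?c + ?e)"
    using bK mult_left_mono[OF KK, of ?e] by (simp add: distrib_right)
  also have "\<dots> \<le> 2 * wt (k - j)"
    unfolding wt using ce by (intro arith)
  finally show "\<bar>of_int (snd k)\<bar> * ?K \<le> 2 * wt (k - j)" .
qed

lemma summable_wt_imp:
  fixes f :: "int \<times> int \<Rightarrow> complex"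
  assumes "(\<lambda>k. wt k * norm (f k)) summable_on UNIV"
  shows "(\<lambda>k. norm (f k)) summable_on UNIV"
    and "(\<Sum>\<^sub>\<infinity>k. norm (f k)) \<le> (\<Sum>\<^sub>\<infinity>k. wt k * norm (f k))"
proof -
  have le: "norm (f k) \<le> wt k * norm (f k)" for k
    using mult_right_mono[OF wt_ge_1, of "norm (f k)" k] by simp
  show s: "(\<lambda>k. norm (f k)) summable_on UNIV"
    using assms by (rule summable_on_comparison_test) (auto simp: le)
  show "(\<Sum>\<^sub>\<infinity>k. norm (f k)) \<le> (\<Sum>\<^sub>\<infinity>k. wt k * norm (f k))"
    using s assms le by (rule infsum_mono)
qed

lemma euler_form_summable:
  fixes f g :: "int \<times> int \<Rightarrow> complex"
  assumes f: "(\<lambda>k. norm (f k)) summable_on UNIV" and g: "(\<lambda>k. wt k * norm (g k)) summable_on UNIV"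
  shows "(\<lambda>j. norm (of_real (euler_kernel j k) * f j * g (k - j))) summable_on UNIV"
proof (rule summable_on_comparison_test)
  show "(\<lambda>j. norm (f j) * (wt (k - j) * norm (g (k - j)))) summable_on UNIV"
    using f g by (rule summable_convolution) auto
  show "norm (of_real (euler_kernel j k) * f j * g (k - j)) \<le> norm (f j) * (wt (k - j) * norm (g (k - j)))" for j
    using mult_right_mono[OF euler_kernel_bounds(1), of "norm (f j) * norm (g (k - j))" j k]
    by (simp add: norm_mult mult_ac)
qed auto

text \<open>Kernel bounds combined with the convolution identity. The unweighted pair controls the
  remainder at y = 0; the pair weighted by |n| is the right-hand side needed to undo the
  multiplication by sin y.\<close>

lemma euler_form_bounds:
  assumes f: "(\<lambda>k. norm (f k)) summable_on UNIV" and g: "(\<lambda>k. wt k * norm (g k)) summable_on UNIV"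
  shows "(\<lambda>k. norm (euler_form f g k)) summable_on UNIV"
    and "(\<Sum>\<^sub>\<infinity>k. norm (euler_form f g k)) \<le> (\<Sum>\<^sub>\<infinity>k. norm (f k)) * (\<Sum>\<^sub>\<infinity>k. wt k * norm (g k))"
    and "(\<lambda>k. \<bar>of_int (snd k)\<bar> * norm (euler_form f g k)) summable_on UNIV"
    and "(\<Sum>\<^sub>\<infinity>k. \<bar>of_int (snd k)\<bar> * norm (euler_form f g k)) \<le>
      2 * ((\<Sum>\<^sub>\<infinity>k. norm (f k)) * (\<Sum>\<^sub>\<infinity>k. wt k * norm (g k)))"
proof -
  let ?C = "\<lambda>k. \<Sum>\<^sub>\<infinity>j. norm (f j) * (wt (k - j) * norm (g (k - j)))"
  note conv = summable_convolution[where f = "\<lambda>k. norm (f k)" and g = "\<lambda>k. wt k * norm (g k)", OF f g]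
  have C: "?C summable_on UNIV" "infsum ?C UNIV = (\<Sum>\<^sub>\<infinity>k. norm (f k)) * (\<Sum>\<^sub>\<infinity>k. wt k * norm (g k))"
    by (rule conv; simp)+
  have Ck: "(\<lambda>j. norm (f j) * (wt (k - j) * norm (g (k - j)))) summable_on UNIV" for k
    by (rule conv) auto
  let ?T = "\<lambda>k j. norm (of_real (euler_kernel j k) * f j * g (k - j))"
  have T: "?T k summable_on UNIV" for k
    using f g by (rule euler_form_summable)
  have le: "norm (euler_form f g k) \<le> infsum (?T k) UNIV" for k
    unfolding euler_form_def using T by (rule norm_infsum_bound)
  have B1: "norm (euler_form f g k) \<le> ?C k" for k
  proof -
    have "infsum (?T k) UNIV \<le> ?C k"
      using T Ck
    proof (rule infsum_mono)
      show "?T k j \<le> norm (f j) * (wt (k - j) * norm (g (k - j)))" for j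
        using mult_right_mono[OF euler_kernel_bounds(1), of "norm (f j) * norm (g (k - j))" j k]
        by (simp add: norm_mult mult_ac)
    qed
    then show ?thesis
      using le[of k] by linarith
  qed
  have B2: "\<bar>of_int (snd k)\<bar> * norm (euler_form f g k) \<le> 2 * ?C k" for k
  proof -
    have "\<bar>of_int (snd k)\<bar> * norm (euler_form f g k) \<le> \<bar>of_int (snd k)\<bar> * infsum (?T k) UNIV"
      using le by (intro mult_left_mono) auto
    also have "\<dots> = (\<Sum>\<^sub>\<infinity>j. \<bar>of_int (snd k)\<bar> * ?T k j)"
      by (rule infsum_cmult_right[symmetric]) (rule T)
    also have "\<dots> \<le> (\<Sum>\<^sub>\<infinity>j. 2 * (norm (f j) * (wt (k - j) * norm (g (k - j)))))"
    proof (rule infsum_mono)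
      show "\<bar>of_int (snd k)\<bar> * ?T k j \<le> 2 * (norm (f j) * (wt (k - j) * norm (g (k - j))))" for j
        using mult_right_mono[OF euler_kernel_bounds(2), of "norm (f j) * norm (g (k - j))" k j]
        by (simp add: norm_mult mult_ac)
    qed (intro summable_on_cmult_right T Ck)+
    also have "\<dots> = 2 * ?C k"
      by (rule infsum_cmult_right) (rule Ck)
    finally show ?thesis .
  qed
  have C2: "(\<lambda>k. 2 * ?C k) summable_on UNIV"
    using C(1) by (rule summable_on_cmult_right)
  show s1: "(\<lambda>k. norm (euler_form f g k)) summable_on UNIV"
    using C(1) by (rule summable_on_comparison_test) (use B1 in auto)
  show s2: "(\<lambda>k. \<bar>of_int (snd k)\<bar> * norm (euler_form f g k)) summable_on UNIV"
    using C2 by (rule summable_on_comparison_test) (use B2 in auto)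
  show "(\<Sum>\<^sub>\<infinity>k. norm (euler_form f g k)) \<le> (\<Sum>\<^sub>\<infinity>k. norm (f k)) * (\<Sum>\<^sub>\<infinity>k. wt k * norm (g k))"
    unfolding C(2)[symmetric] using s1 C(1) B1 by (rule infsum_mono)
  have "(\<Sum>\<^sub>\<infinity>k. \<bar>of_int (snd k)\<bar> * norm (euler_form f g k)) \<le> (\<Sum>\<^sub>\<infinity>k. 2 * ?C k)"
    using s2 C2 B2 by (rule infsum_mono)
  also have "\<dots> = 2 * infsum ?C UNIV"
    using C(1) by (rule infsum_cmult_right)
  finally show "(\<Sum>\<^sub>\<infinity>k. \<bar>of_int (snd k)\<bar> * norm (euler_form f g k)) \<le>
      2 * ((\<Sum>\<^sub>\<infinity>k. norm (f k)) * (\<Sum>\<^sub>\<infinity>k. wt k * norm (g k)))"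
    unfolding C(2) .
qed

lemma euler_form_add_left:
  assumes f: "(\<lambda>k. norm (f k)) summable_on UNIV" and f': "(\<lambda>k. norm (f' k)) summable_on UNIV"
    and g: "(\<lambda>k. wt k * norm (g k)) summable_on UNIV"
  shows "euler_form (\<lambda>k. f k + f' k) g k = euler_form f g k + euler_form f' g k"
  unfolding euler_form_def
  using abs_summable_summable[OF euler_form_summable[OF f g, of k]]
    abs_summable_summable[OF euler_form_summable[OF f' g, of k]]
  by (subst infsum_add[symmetric]) (simp_all only: distrib_left distrib_right)

lemma euler_form_add_right:
  assumes f: "(\<lambda>k. norm (f k)) summable_on UNIV" and g: "(\<lambda>k. wt k * norm (g k)) summable_on UNIV"
    and g': "(\<lambda>k. wt k * norm (g' k)) summable_on UNIV"
  shows "euler_form f (\<lambda>k. g k + g' k) k = euler_form f g k + euler_form f g' k"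
  unfolding euler_form_def
  using abs_summable_summable[OF euler_form_summable[OF f g, of k]]
    abs_summable_summable[OF euler_form_summable[OF f g', of k]]
  by (subst infsum_add[symmetric]) (simp_all only: distrib_left distrib_right)

lemma euler_form_scale_left: "euler_form (\<lambda>k. c * f k) g k = c * euler_form f g k"
  unfolding euler_form_def by (subst infsum_cmult_right'[symmetric]) (simp add: mult_ac)

lemma euler_form_scale_right: "euler_form f (\<lambda>k. c * g k) k = c * euler_form f g k"
  unfolding euler_form_def by (subst infsum_cmult_right'[symmetric]) (simp add: mult_ac)

lemma euler_form_finite_left:
  assumes "finite S" "\<And>j. j \<notin> S \<Longrightarrow> f j = 0"
  shows "euler_form f g k = (\<Sum>j\<in>S. of_real (euler_kernel j k) * f j * g (k - j))"
  unfolding euler_form_def using assms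
  by (subst infsum_cong_neutral[where T = S]) auto

lemma euler_form_finite_right:
  assumes "finite S" "\<And>j. j \<notin> S \<Longrightarrow> g j = 0"
  shows "euler_form f g k = (\<Sum>j\<in>S. of_real (euler_kernel (k - j) k) * f (k - j) * g j)"
proof -
  have "euler_form f g k = (\<Sum>\<^sub>\<infinity>j. of_real (euler_kernel (k - j) k) * f (k - j) * g j)"
    unfolding euler_form_def
    by (rule infsum_reindex_bij_witness[where i = "\<lambda>j. k - j" and j = "\<lambda>j. k - j"]) auto
  also have "\<dots> = (\<Sum>j\<in>S. of_real (euler_kernel (k - j) k) * f (k - j) * g j)"
    using assms by (subst infsum_cong_neutral[where T = S]) auto
  finally show ?thesis .
qed

section \<open>Multiplication by sin y as a recurrence in the second frequency\<close>

lemma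
  fixes f g :: "'a \<Rightarrow> 'b::real_normed_vector"
  assumes "f summable_on A" "g summable_on A"
  shows summable_on_diff: "(\<lambda>x. f x - g x) summable_on A"
    and infsum_diff: "(\<Sum>\<^sub>\<infinity>x\<in>A. f x - g x) = infsum f A - infsum g A"
  using assms summable_on_add[of f A "\<lambda>x. - g x"] infsum_add[of f A "\<lambda>x. - g x"]
  by (simp_all add: summable_on_uminus infsum_uminus)

lemma infsum_shift:
  fixes f :: "'a::ab_group_add \<Rightarrow> 'b::{comm_monoid_add, t2_space}"
  shows "(\<Sum>\<^sub>\<infinity>k. f (k + c)) = infsum f UNIV"
  by (rule infsum_reindex_bij_witness[where i = "\<lambda>k. k - c" and j = "\<lambda>k. k + c"]) auto

lemma summable_shift:
  fixes f :: "'a::ab_group_add \<Rightarrow> 'b::{comm_monoid_add, t2_space}"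
  shows "(\<lambda>k. f (k + c)) summable_on UNIV \<longleftrightarrow> f summable_on UNIV"
  by (rule summable_on_reindex_bij_witness[where i = "\<lambda>k. k - c" and j = "\<lambda>k. k + c"]) auto

text \<open>Multiply the recurrence by \<open>n\<close> and sum: after shifting, the weights \<open>n + 1\<close> and \<open>n - 1\<close>
  differ by \<open>2\<close>. This inverts the multiplication by \<open>sin y\<close> with the loss of one derivative.\<close>

lemma recurrence_sum_bound:
  fixes G N :: "int \<times> int \<Rightarrow> complex"
  assumes rec: "\<And>k. G (k - (0, 1)) - G (k + (0, 1)) = 2 * N k"
    and G: "(\<lambda>k. norm (G k)) summable_on UNIV" "(\<lambda>k. \<bar>of_int (snd k)\<bar> * norm (G k)) summable_on UNIV"
    and N: "(\<lambda>k. \<bar>of_int (snd k)\<bar> * norm (N k)) summable_on UNIV"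
  shows "(\<Sum>\<^sub>\<infinity>k. norm (G k)) \<le> (\<Sum>\<^sub>\<infinity>k. \<bar>of_int (snd k)\<bar> * norm (N k))"
proof -
  let ?n = "\<lambda>k :: int \<times> int. of_int (snd k) :: real"
  have nG: "(\<lambda>k. ?n k * norm (G k)) summable_on UNIV"
    by (rule abs_summable_summable) (use G(2) in \<open>simp add: abs_mult\<close>)
  define u where "u = (\<lambda>k. (?n k + 1) * norm (G k))"
  define v where "v = (\<lambda>k. (?n k - 1) * norm (G k))"
  have u: "u summable_on UNIV" and v: "v summable_on UNIV"
    using summable_on_add[OF nG G(1)] summable_on_diff[OF nG G(1)]
    by (simp_all add: u_def v_def distrib_right left_diff_distrib)
  have u': "(\<lambda>k. u (k + (0, - 1))) summable_on UNIV" and v': "(\<lambda>k. v (k + (0, 1))) summable_on UNIV"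
    using u v by (simp_all add: summable_shift)
  have le: "u (k + (0, - 1)) - v (k + (0, 1)) \<le> 2 * (\<bar>?n k\<bar> * norm (N k))" for k
  proof -
    let ?A = "G (k - (0, 1))" and ?B = "G (k + (0, 1))"
    \<comment> \<open>The reverse triangle inequality passes the recurrence from the complex values
      of \<open>G\<close> to their norms, whose weighted sums telescope.\<close>
    have "\<bar>norm ?A - norm ?B\<bar> \<le> norm (?A - ?B)"
      by (rule norm_triangle_ineq3)
    then have d: "\<bar>norm ?A - norm ?B\<bar> \<le> 2 * norm (N k)"
      unfolding rec by (simp add: norm_mult)
    have "u (k + (0, - 1)) - v (k + (0, 1)) = ?n k * (norm ?A - norm ?B)"
      by (cases k) (simp add: u_def v_def right_diff_distrib)
    also have "\<dots> \<le> \<bar>?n k\<bar> * \<bar>norm ?A - norm ?B\<bar>"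
      by (metis abs_ge_self abs_mult)
    also have "\<dots> \<le> \<bar>?n k\<bar> * (2 * norm (N k))"
      using d by (intro mult_left_mono) auto
    finally show ?thesis by simp
  qed
  have "2 * (\<Sum>\<^sub>\<infinity>k. norm (G k)) = (\<Sum>\<^sub>\<infinity>k. u k - v k)"
    by (subst infsum_cmult_right'[symmetric]) (simp add: u_def v_def left_diff_distrib[symmetric])
  also have "\<dots> = infsum u UNIV - infsum v UNIV"
    using u v by (rule infsum_diff)
  also have "\<dots> = (\<Sum>\<^sub>\<infinity>k. u (k + (0, - 1)) - v (k + (0, 1)))"
    using infsum_diff[OF u' v'] by (simp add: infsum_shift)
  also have "\<dots> \<le> (\<Sum>\<^sub>\<infinity>k. 2 * (\<bar>?n k\<bar> * norm (N k)))"
    using summable_on_diff[OF u' v'] summable_on_cmult_right[OF N] le by (rule infsum_mono)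
  also have "\<dots> = 2 * (\<Sum>\<^sub>\<infinity>k. \<bar>?n k\<bar> * norm (N k))"
    by (rule infsum_cmult_right')
  finally show ?thesis by simp
qed

text \<open>Summing over \<open>n\<close> evaluates at \<open>y = 0\<close>, where \<open>sin y\<close> vanishes.\<close>

lemma recurrence_telescope:
  fixes G N :: "int \<times> int \<Rightarrow> complex"
  assumes rec: "\<And>k. G (k - (0, 1)) - G (k + (0, 1)) = 2 * N k"
    and G: "(\<lambda>k. norm (G k)) summable_on UNIV"
  shows "(\<Sum>\<^sub>\<infinity>n. N (m, n)) = 0"
proof -
  have "(\<lambda>n. norm (G (m, n))) summable_on UNIV"
    using summable_on_SigmaD1[of "\<lambda>m n. norm (G (m, n))" UNIV "\<lambda>_. UNIV" m] G
    by (simp add: case_prod_unfold)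
  then have s: "(\<lambda>n. G (m, n)) summable_on UNIV"
    by (rule abs_summable_summable)
  have s': "(\<lambda>n. G (m, n + c)) summable_on UNIV" for c
    using summable_shift[of "\<lambda>n. G (m, n)" c] s by simp
  have "2 * (\<Sum>\<^sub>\<infinity>n. N (m, n)) = (\<Sum>\<^sub>\<infinity>n. G (m, n + - 1) - G (m, n + 1))"
    by (subst infsum_cmult_right'[symmetric]) (simp add: rec[symmetric])
  also have "\<dots> = 0"
    using infsum_diff[OF s' s', of "- 1" 1] infsum_shift[of "\<lambda>n. G (m, n)" "- 1"]
      infsum_shift[of "\<lambda>n. G (m, n)" 1] by simp
  finally show ?thesis by simp
qed

text \<open>Cauchy-Schwarz with the middle weight as geometric mean of 1 and \<open>wt^2\<close>,
  obtained by summing 2 t wt <= t^2 + wt^2 and optimising over the real parameter t.\<close>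

lemma weighted_interpolation:
  fixes f :: "int \<times> int \<Rightarrow> complex"
  assumes s: "(\<lambda>k. (wt k)\<^sup>2 * norm (f k)) summable_on UNIV"
  shows "(\<lambda>k. wt k * norm (f k)) summable_on UNIV"
    and "(\<Sum>\<^sub>\<infinity>k. wt k * norm (f k))\<^sup>2 \<le> (\<Sum>\<^sub>\<infinity>k. norm (f k)) * (\<Sum>\<^sub>\<infinity>k. (wt k)\<^sup>2 * norm (f k))"
proof -
  have "wt k * norm (f k) \<le> (wt k)\<^sup>2 * norm (f k)" for k
    using wt_ge_1[of k] by (intro mult_right_mono) (auto simp: power2_eq_square)
  then show s1: "(\<lambda>k. wt k * norm (f k)) summable_on UNIV"
    by (intro summable_on_comparison_test[OF s]) auto
  have s0: "(\<lambda>k. norm (f k)) summable_on UNIV"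
    using s1 by (rule summable_wt_imp)
  define X0 X2 X4 where "X0 = (\<Sum>\<^sub>\<infinity>k. norm (f k))" and "X2 = (\<Sum>\<^sub>\<infinity>k. wt k * norm (f k))"
    and "X4 = (\<Sum>\<^sub>\<infinity>k. (wt k)\<^sup>2 * norm (f k))"
  have q: "2 * t * X2 \<le> t\<^sup>2 * X0 + X4" for t
  proof -
    have "2 * t * X2 = (\<Sum>\<^sub>\<infinity>k. 2 * t * (wt k * norm (f k)))"
      unfolding X2_def by (rule infsum_cmult_right'[symmetric])
    also have "\<dots> \<le> (\<Sum>\<^sub>\<infinity>k. t\<^sup>2 * norm (f k) + (wt k)\<^sup>2 * norm (f k))"
    proof (rule infsum_mono)
      show "2 * t * (wt k * norm (f k)) \<le> t\<^sup>2 * norm (f k) + (wt k)\<^sup>2 * norm (f k)" for k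
        using mult_right_mono[OF sum_squares_bound[of t "wt k"], of "norm (f k)"]
        by (simp add: distrib_right mult.assoc)
    qed (intro summable_on_add summable_on_cmult_right s0 s1 s)+
    also have "\<dots> = t\<^sup>2 * X0 + X4"
      unfolding X0_def X4_def
      by (subst infsum_add) (auto intro: summable_on_cmult_right s0 s simp: infsum_cmult_right')
    finally show ?thesis .
  qed
  have X0: "X0 \<ge> 0"
    unfolding X0_def by (rule infsum_nonneg) auto
  have "X2\<^sup>2 \<le> X0 * X4"
  proof (cases "X0 = 0")
    case True
    have "X2 = 0"
    proof (rule ccontr)
      assume "X2 \<noteq> 0"
      then show False
        \<comment> \<open>This t makes the left side X4 + 1 while the right side is X4.\<close>
        using q[of "(X4 + 1) / (2 * X2)"] True by simp
    qed
    then show ?thesis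
      using True by simp
  next
    case False
    have "2 * X2\<^sup>2 / X0 \<le> X2\<^sup>2 / X0 + X4"
      \<comment> \<open>The minimiser of the quadratic in t.\<close>
      using q[of "X2 / X0"] False by (simp add: power2_eq_square)
    then show ?thesis
      using False X0 by (simp add: field_simps)
  qed
  then show "(\<Sum>\<^sub>\<infinity>k. wt k * norm (f k))\<^sup>2 \<le> (\<Sum>\<^sub>\<infinity>k. norm (f k)) * (\<Sum>\<^sub>\<infinity>k. (wt k)\<^sup>2 * norm (f k))"
    unfolding X0_def X2_def X4_def .
qed

text \<open>The Fourier coefficients of \<open>sin (l y) + cos x\<close>.\<close>

definition kernel_coeff :: "nat \<Rightarrow> int \<times> int \<Rightarrow> complex" where
  "kernel_coeff l k = (if k = (0, int l) then - \<i> / 2 else 0) + (if k = (0, - int l) then \<i> / 2 else 0)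
     + (if k = (1, 0) then 1 / 2 else 0) + (if k = (- 1, 0) then 1 / 2 else 0)"

lemma kernel_coeff_support:
  "k \<notin> {(0, int l), (0, - int l), (1, 0), (- 1, 0)} \<Longrightarrow> kernel_coeff l k = 0"
  by (auto simp: kernel_coeff_def)

lemma summable_kernel_coeff: "(\<lambda>k. c k * norm (kernel_coeff l k)) summable_on UNIV" for c :: "_ \<Rightarrow> real"
  by (rule summable_on_cong_neutral[where S = "{(0, int l), (0, - int l), (1, 0), (- 1, 0)}", THEN iffD1])
    (auto simp: kernel_coeff_support)

text \<open>The modes sin(l y) and cos x are Laplace eigenfunctions, so the two orders of their
  interaction have opposite signs and sizes 1/l and l. They would cancel for l = 1, where the
  eigenvalues agree; for l >= 2 the difference l - 1/l survives.\<close>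

lemma euler_form_kernel_coeff:
  assumes "l \<ge> 2"
  shows "euler_form (kernel_coeff l) (kernel_coeff l) (1, n) =
    (if n = int l \<or> n = - int l then - \<i> / 4 * (real l - 1 / real l) else 0)"
proof -
  let ?w = "kernel_coeff l"
  let ?t = "\<lambda>j. of_real (euler_kernel j (1, n)) * ?w j * ?w ((1, n) - j)"
  have l: "l \<noteq> 0"
    using assms by simp
  have "euler_form ?w ?w (1, n) = (\<Sum>j\<in>{(0, int l), (0, - int l), (1, 0), (- 1, 0)}. ?t j)"
    by (rule euler_form_finite_left) (auto simp: kernel_coeff_support)
  also have "\<dots> = ?t (0, int l) + (?t (0, - int l) + (?t (1, 0) + ?t (- 1, 0)))"
    using l by simp
  also have "?t (0, int l) = (if n = int l then \<i> / (4 * of_nat l) else 0)"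
    using l by (simp add: kernel_coeff_def euler_kernel_def power2_eq_square)
  also have "?t (0, - int l) = (if n = - int l then \<i> / (4 * of_nat l) else 0)"
    using l by (simp add: kernel_coeff_def euler_kernel_def power2_eq_square add_eq_0_iff)
  also have "?t (1, 0) = (if n = int l \<or> n = - int l then - \<i> / 4 * of_nat l else 0)"
    using l by (auto simp: kernel_coeff_def euler_kernel_def)
  also have "?t (- 1, 0) = 0"
    by (simp add: kernel_coeff_def)
  finally show ?thesis
    using l by (auto simp: field_simps)
qed

text \<open>The modes n = l and n = -l enter with equal sign, as for cos(l y), so nothing cancels at
  y = 0.\<close>

lemma infsum_euler_form_kernel_coeff:
  assumes "l \<ge> 2"
  shows "(\<Sum>\<^sub>\<infinity>n. euler_form (kernel_coeff l) (kernel_coeff l) (1, n)) = - \<i> / 2 * (real l - 1 / real l)"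
proof -
  have "(\<Sum>\<^sub>\<infinity>n. euler_form (kernel_coeff l) (kernel_coeff l) (1, n)) =
      (\<Sum>n\<in>{int l, - int l}. - \<i> / 4 * (real l - 1 / real l))"
    unfolding euler_form_kernel_coeff[OF assms]
    by (subst infsum_cong_neutral[where T = "{int l, - int l}"]) auto
  then show ?thesis
    using assms by simp
qed

section \<open>The perturbation argument\<close>

text \<open>Up to a factor \<open>\<i>\<close>, the multiplier of \<open>(1 + \<Delta>\<^sup>-\<^sup>1) \<partial>\<^sub>x\<close>.\<close>

definition linear_coeff :: "(int \<times> int \<Rightarrow> complex) \<Rightarrow> int \<times> int \<Rightarrow> complex" where
  "linear_coeff b k = of_real (of_int (fst k) * (1 - 1 / of_int ((fst k)\<^sup>2 + (snd k)\<^sup>2))) * b k"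

text \<open>Spectral gap: off the kernel |m| >= 1, and the integer m^2 + n^2 is at least 2, so the
  factor 1 - 1/(m^2 + n^2) is at least 1/2.\<close>

lemma linear_coeff_lower:
  assumes "b k = 0 \<or> fst k \<noteq> 0 \<and> (fst k)\<^sup>2 + (snd k)\<^sup>2 \<noteq> 1"
  shows "norm (b k) \<le> 2 * norm (linear_coeff b k)"
proof (cases "b k = 0")
  case False
  then have m: "fst k \<noteq> 0" and "(fst k)\<^sup>2 + (snd k)\<^sup>2 \<noteq> 1"
    using assms by auto
  moreover have "0 < (fst k)\<^sup>2" "0 \<le> (snd k)\<^sup>2"
    using m by simp_all
  ultimately have "2 \<le> (fst k)\<^sup>2 + (snd k)\<^sup>2"
    by linarith
  then have q: "2 \<le> (of_int ((fst k)\<^sup>2 + (snd k)\<^sup>2) :: real)"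
    by linarith
  have "1 \<le> \<bar>of_int (fst k) :: real\<bar>"
    using m by linarith
  moreover have "1 / 2 \<le> \<bar>1 - 1 / of_int ((fst k)\<^sup>2 + (snd k)\<^sup>2) :: real\<bar>"
    using q by (simp add: field_simps)
  ultimately have "1 * (1 / 2) \<le> \<bar>of_int (fst k) :: real\<bar> * \<bar>1 - 1 / of_int ((fst k)\<^sup>2 + (snd k)\<^sup>2) :: real\<bar>"
    by (intro mult_mono) auto
  then have "1 / 2 * norm (b k) \<le> norm (linear_coeff b k)"
    unfolding linear_coeff_def norm_mult norm_of_real abs_mult by (intro mult_right_mono) auto
  then show ?thesis by simp
qed (simp add: linear_coeff_def)

text \<open>These bounds supply the summability, plain and weighted by |n|, that the recurrence
  argument requires of its unknown. They rest on |m| <= wt and |m n| <= wt.\<close>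

lemma linear_coeff_upper: "norm (linear_coeff b k) \<le> wt k * norm (b k)"
  "\<bar>of_int (snd k)\<bar> * norm (linear_coeff b k) \<le> wt k * norm (b k)"
proof -
  let ?m = "of_int (fst k) :: real" and ?n = "of_int (snd k) :: real"
  let ?r = "1 - 1 / of_int ((fst k)\<^sup>2 + (snd k)\<^sup>2) :: real"
  have r: "\<bar>?r\<bar> \<le> 1"
  proof (cases "(fst k)\<^sup>2 + (snd k)\<^sup>2 = 0")
    case False
    then have "1 \<le> (fst k)\<^sup>2 + (snd k)\<^sup>2"
      using zero_le_power2[of "fst k"] zero_le_power2[of "snd k"] by linarith
    then have "1 \<le> (of_int ((fst k)\<^sup>2 + (snd k)\<^sup>2) :: real)"
      by linarith
    then show ?thesis by (simp add: field_simps)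
  qed simp
  have n: "norm (linear_coeff b k) = \<bar>?m\<bar> * \<bar>?r\<bar> * norm (b k)"
    unfolding linear_coeff_def norm_mult norm_of_real abs_mult ..
  have mr: "\<bar>?m\<bar> * \<bar>?r\<bar> \<le> \<bar>?m\<bar>"
    using mult_left_mono[OF r, of "\<bar>?m\<bar>"] by simp
  have m: "\<bar>?m\<bar> \<le> wt k" "\<bar>?n\<bar> * \<bar>?m\<bar> \<le> wt k"
  proof -
    have *: "x \<le> 1 + x\<^sup>2 + y\<^sup>2" "y * x \<le> 1 + x\<^sup>2 + y\<^sup>2" for x y :: real
    proof -
      have sq: "2 * x \<le> x\<^sup>2 + 1" "2 * (y * x) \<le> y\<^sup>2 + x\<^sup>2" "0 \<le> x\<^sup>2" "0 \<le> y\<^sup>2"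
        using sum_squares_bound[of x 1] sum_squares_bound[of y x] by (simp_all add: mult.assoc)
      show "x \<le> 1 + x\<^sup>2 + y\<^sup>2"
        using sq by argo
      show "y * x \<le> 1 + x\<^sup>2 + y\<^sup>2"
        using sq by argo
    qed
    show "\<bar>?m\<bar> \<le> wt k" "\<bar>?n\<bar> * \<bar>?m\<bar> \<le> wt k"
      using *(1)[of "\<bar>?m\<bar>" "\<bar>?n\<bar>"] *(2)[where x = "\<bar>?m\<bar>" and y = "\<bar>?n\<bar>"] by (simp_all add: wt_def)
  qed
  have "\<bar>?m\<bar> * \<bar>?r\<bar> \<le> wt k"
    using mr m by linarith
  then show "norm (linear_coeff b k) \<le> wt k * norm (b k)"
    unfolding n by (rule mult_right_mono) simp
  have "\<bar>?n\<bar> * (\<bar>?m\<bar> * \<bar>?r\<bar>) \<le> wt k"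
    using mult_left_mono[OF mr, of "\<bar>?n\<bar>"] m by linarith
  then show "\<bar>?n\<bar> * norm (linear_coeff b k) \<le> wt k * norm (b k)"
    unfolding n mult.assoc[symmetric] by (intro mult_right_mono) simp_all
qed

text \<open>The analytic core, purely in terms of coefficients. The smallness threshold involves W,
  hence \<open>l\<close>, but not \<open>a\<close>: all final estimates are homogeneous of degree
  two in \<open>a\<close>.\<close>

lemma no_small_solution:
  fixes b \<eta> :: "int \<times> int \<Rightarrow> complex" and a :: real
  assumes l: "l \<ge> 2" and a: "a > 0"
    and b: "\<And>k. b k = of_real a * kernel_coeff l k + \<eta> k"
    and \<eta>0: "\<And>k. fst k = 0 \<or> (fst k)\<^sup>2 + (snd k)\<^sup>2 = 1 \<Longrightarrow> \<eta> k = 0"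
    and sum: "(\<lambda>k. (wt k)\<^sup>2 * norm (\<eta> k)) summable_on UNIV"
    and W: "W = (\<Sum>\<^sub>\<infinity>k. wt k * norm (kernel_coeff l k))"
    and small: "(\<Sum>\<^sub>\<infinity>k. (wt k)\<^sup>2 * norm (\<eta> k)) \<le> (1 / (4 + 32 * W\<^sup>2))\<^sup>2"
    and eq: "\<And>k. linear_coeff b (k - (0, 1)) - linear_coeff b (k + (0, 1)) = 2 * euler_form b b k"
  shows False
proof -
  let ?w = "\<lambda>k. of_real a * kernel_coeff l k"
  define s where "s = 1 / (4 + 32 * W\<^sup>2)"
  define X0 X2 where "X0 = (\<Sum>\<^sub>\<infinity>k. norm (\<eta> k))" and "X2 = (\<Sum>\<^sub>\<infinity>k. wt k * norm (\<eta> k))"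
  have b_eq: "b = (\<lambda>k. ?w k + \<eta> k)"
    using b by auto
  have s\<eta>: "(\<lambda>k. wt k * norm (\<eta> k)) summable_on UNIV"
    using sum by (rule weighted_interpolation)
  have sw: "(\<lambda>k. wt k * norm (?w k)) summable_on UNIV"
    using summable_on_cmult_right[OF summable_kernel_coeff[of wt l], of a] a by (simp add: norm_mult mult_ac)
  have Ww: "(\<Sum>\<^sub>\<infinity>k. wt k * norm (?w k)) = a * W"
    unfolding W using a by (subst infsum_cmult_right'[symmetric]) (simp add: norm_mult mult_ac)
  have sb: "(\<lambda>k. wt k * norm (b k)) summable_on UNIV"
    and Xb: "(\<Sum>\<^sub>\<infinity>k. wt k * norm (b k)) \<le> a * W + X2"
  proof -
    have le: "wt k * norm (b k) \<le> wt k * norm (?w k) + wt k * norm (\<eta> k)" for k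
      unfolding b_eq distrib_left[symmetric] by (intro mult_left_mono norm_triangle_ineq) simp
    have s: "(\<lambda>k. wt k * norm (?w k) + wt k * norm (\<eta> k)) summable_on UNIV"
      using sw s\<eta> by (rule summable_on_add)
    then show 1: "(\<lambda>k. wt k * norm (b k)) summable_on UNIV"
      by (rule summable_on_comparison_test) (use le in auto)
    have "(\<Sum>\<^sub>\<infinity>k. wt k * norm (b k)) \<le> (\<Sum>\<^sub>\<infinity>k. wt k * norm (?w k) + wt k * norm (\<eta> k))"
      using 1 s le by (rule infsum_mono)
    also have "\<dots> = a * W + X2"
      unfolding X2_def Ww[symmetric] using sw s\<eta> by (rule infsum_add)
    finally show "(\<Sum>\<^sub>\<infinity>k. wt k * norm (b k)) \<le> a * W + X2" .
  qed
  have pos: "0 \<le> W" "0 \<le> X0" "0 \<le> X2"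
    unfolding W X0_def X2_def by (intro infsum_nonneg; simp)+
  \<comment> \<open>The multiplier vanishes on kernel modes, so the linear side of the equation sees
    only \<eta>.\<close>
  have lin: "linear_coeff b = linear_coeff \<eta>"
  proof
    fix k
    show "linear_coeff b k = linear_coeff \<eta> k"
    proof (cases "fst k = 0 \<or> (fst k)\<^sup>2 + (snd k)\<^sup>2 = 1")
      case True
      then show ?thesis
        by (elim disjE) (simp_all add: linear_coeff_def del: of_int_add of_int_power)
    next
      case False
      then have "kernel_coeff l k = 0"
        by (intro kernel_coeff_support) auto
      then show ?thesis by (simp add: linear_coeff_def b)
    qed
  qed
  let ?G = "linear_coeff \<eta>"
  note rec = eq[unfolded lin]
  have G: "(\<lambda>k. norm (?G k)) summable_on UNIV" "(\<lambda>k. \<bar>of_int (snd k)\<bar> * norm (?G k)) summable_on UNIV"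
    by (rule summable_on_comparison_test[OF s\<eta>]; simp add: linear_coeff_upper)+
  note sb0 = summable_wt_imp(1)[OF sb] and s\<eta>0 = summable_wt_imp(1)[OF s\<eta>] and sw0 = summable_wt_imp(1)[OF sw]

  \<comment> \<open>The factor 4 is the product of the 2 from the spectral gap and the 2 from the
    |n|-weighted bound on N.\<close>
  have X0_le: "X0 \<le> 4 * (a * W + X2)\<^sup>2"
  proof -
    have "X0 \<le> (\<Sum>\<^sub>\<infinity>k. 2 * norm (?G k))"
      unfolding X0_def
    proof (rule infsum_mono)
      show "norm (\<eta> k) \<le> 2 * norm (?G k)" for k
        using \<eta>0[of k] by (intro linear_coeff_lower) auto
    qed (use s\<eta>0 G in \<open>auto intro: summable_on_cmult_right\<close>)
    also have "\<dots> = 2 * (\<Sum>\<^sub>\<infinity>k. norm (?G k))"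
      by (rule infsum_cmult_right')
    also have "\<dots> \<le> 2 * (\<Sum>\<^sub>\<infinity>k. \<bar>of_int (snd k)\<bar> * norm (euler_form b b k))"
      using recurrence_sum_bound[OF rec G euler_form_bounds(3)[OF sb0 sb]] by simp
    also have "\<dots> \<le> 2 * (2 * ((\<Sum>\<^sub>\<infinity>k. norm (b k)) * (\<Sum>\<^sub>\<infinity>k. wt k * norm (b k))))"
      using euler_form_bounds(4)[OF sb0 sb] by simp
    also have "(\<Sum>\<^sub>\<infinity>k. norm (b k)) * (\<Sum>\<^sub>\<infinity>k. wt k * norm (b k)) \<le> (a * W + X2) * (a * W + X2)"
      using Xb summable_wt_imp(2)[OF sb] pos a
      by (intro mult_mono) (auto intro: infsum_nonneg)
    finally show ?thesis
      by (simp add: power2_eq_square)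
  qed

  have a2_le: "a\<^sup>2 * (3 / 4) \<le> a * W * X2 + X2 * (a * W + X2)"
  proof -
    \<comment> \<open>Keeping the full \<open>b\<close> in the second slot of the last term leaves
      only two remainder terms.\<close>
    let ?R = "\<lambda>k. euler_form ?w \<eta> k + euler_form \<eta> b k"
    have split: "euler_form b b k = of_real (a\<^sup>2) * euler_form (kernel_coeff l) (kernel_coeff l) k + ?R k" for k
    proof -
      have "euler_form b b k = euler_form ?w b k + euler_form \<eta> b k"
        using euler_form_add_left[OF sw0 s\<eta>0 sb] by (simp add: b_eq)
      also have "euler_form ?w b k = euler_form ?w ?w k + euler_form ?w \<eta> k"
        using euler_form_add_right[OF sw0 sw s\<eta>] by (simp add: b_eq)
      also have "euler_form ?w ?w k = of_real (a\<^sup>2) * euler_form (kernel_coeff l) (kernel_coeff l) k"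
        by (simp add: euler_form_scale_left euler_form_scale_right power2_eq_square)
      finally show ?thesis by (simp add: add.assoc)
    qed
    note e1 = euler_form_bounds[OF sw0 s\<eta>] and e2 = euler_form_bounds[OF s\<eta>0 sb]
    have sR: "(\<lambda>k. norm (?R k)) summable_on UNIV"
      using summable_on_add[OF e1(1) e2(1)]
      by (rule summable_on_comparison_test) (auto intro: norm_triangle_ineq)
    have sR1: "(\<lambda>n. norm (?R (1, n))) summable_on UNIV"
      using summable_on_SigmaD1[of "\<lambda>m n. norm (?R (m, n))" UNIV "\<lambda>_. UNIV" 1] sR
      by (simp add: case_prod_unfold)
    have sE: "(\<lambda>n. of_real (a\<^sup>2) * euler_form (kernel_coeff l) (kernel_coeff l) (1, n)) summable_on UNIV"
      unfolding euler_form_kernel_coeff[OF l]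
      by (rule summable_on_cong_neutral[where S = "{int l, - int l}", THEN iffD1]) auto
    \<comment> \<open>Row m = 1 carries the sin x of the leading part; its sum over n is the value
      at y = 0.\<close>
    have "0 = (\<Sum>\<^sub>\<infinity>n. euler_form b b (1, n))"
      using recurrence_telescope[OF rec G(1), of 1] by simp
    also have "\<dots> = (\<Sum>\<^sub>\<infinity>n. of_real (a\<^sup>2) * euler_form (kernel_coeff l) (kernel_coeff l) (1, n))
        + (\<Sum>\<^sub>\<infinity>n. ?R (1, n))"
      unfolding split using sE abs_summable_summable[OF sR1] by (rule infsum_add)
    also have "(\<Sum>\<^sub>\<infinity>n. of_real (a\<^sup>2) * euler_form (kernel_coeff l) (kernel_coeff l) (1, n))
        = of_real (a\<^sup>2) * (- \<i> / 2 * (real l - 1 / real l))"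
      unfolding infsum_cmult_right' infsum_euler_form_kernel_coeff[OF l] ..
    finally have "of_real (a\<^sup>2) * (\<i> / 2 * (real l - 1 / real l)) = (\<Sum>\<^sub>\<infinity>n. ?R (1, n))"
      by (simp add: add_eq_0_iff minus_equation_iff)
    then have "norm (complex_of_real (a\<^sup>2) * (\<i> / 2 * complex_of_real (real l - 1 / real l))) =
        norm (\<Sum>\<^sub>\<infinity>n. ?R (1, n))"
      by simp
    then have "a\<^sup>2 * (\<bar>real l - 1 / real l\<bar> / 2) = norm (\<Sum>\<^sub>\<infinity>n. ?R (1, n))"
      unfolding norm_mult norm_divide norm_of_real by simp
    \<comment> \<open>l - 1/l is increasing in l and equals 3/2 at l = 2; halved, it gives the 3/4
      of the claim.\<close>
    moreover have "3 / 2 \<le> real l - 1 / real l"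
    proof -
      have "1 / real l \<le> 1 / 2"
        using l by (intro divide_left_mono) auto
      moreover have "2 \<le> real l"
        using l by simp
      ultimately show ?thesis by linarith
    qed
    then have "a\<^sup>2 * (3 / 4) \<le> a\<^sup>2 * (\<bar>real l - 1 / real l\<bar> / 2)"
      by (intro mult_left_mono) auto
    ultimately have "a\<^sup>2 * (3 / 4) \<le> norm (\<Sum>\<^sub>\<infinity>n. ?R (1, n))"
      by simp
    also have "\<dots> \<le> (\<Sum>\<^sub>\<infinity>n. norm (?R (1, n)))"
      using sR1 by (rule norm_infsum_bound)
    also have "\<dots> = (\<Sum>\<^sub>\<infinity>k\<in>range (Pair 1). norm (?R k))"
      by (subst infsum_reindex) (auto simp: inj_on_def o_def)
    also have "\<dots> \<le> (\<Sum>\<^sub>\<infinity>k. norm (?R k))"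
      using sR by (intro infsum_mono_neutral summable_on_subset_banach[OF sR]) auto
    also have "\<dots> \<le> (\<Sum>\<^sub>\<infinity>k. norm (euler_form ?w \<eta> k) + norm (euler_form \<eta> b k))"
      using sR summable_on_add[OF e1(1) e2(1)] norm_triangle_ineq by (rule infsum_mono)
    also have "\<dots> = (\<Sum>\<^sub>\<infinity>k. norm (euler_form ?w \<eta> k)) + (\<Sum>\<^sub>\<infinity>k. norm (euler_form \<eta> b k))"
      using e1(1) e2(1) by (rule infsum_add)
    also have "\<dots> \<le> (\<Sum>\<^sub>\<infinity>k. norm (?w k)) * X2 + X0 * (\<Sum>\<^sub>\<infinity>k. wt k * norm (b k))"
      unfolding X0_def X2_def by (rule add_mono[OF e1(2) e2(2)])
    also have "\<dots> \<le> a * W * X2 + X2 * (a * W + X2)"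
    proof (intro add_mono mult_mono)
      show "(\<Sum>\<^sub>\<infinity>k. norm (?w k)) \<le> a * W"
        using summable_wt_imp(2)[OF sw] unfolding Ww .
      show "X0 \<le> X2"
        using summable_wt_imp(2)[OF s\<eta>] unfolding X0_def X2_def .
    qed (use pos a Xb in \<open>auto intro: infsum_nonneg\<close>)
    finally show ?thesis .
  qed

  \<comment> \<open>The bound 1/4 lets half of X0 be absorbed: X0 <= 8 (a W)^2 + 8 X2^2 with X2^2 <=
    X0/16. The bound on 32 s W^2 makes the final coefficient 12 s W^2 less than 3/4.\<close>
  have s: "0 < s" "s \<le> 1 / 4" "s * (32 * W\<^sup>2) < 1"
    by (auto simp: s_def field_simps add_pos_nonneg)
  have "X2\<^sup>2 \<le> X0 * (\<Sum>\<^sub>\<infinity>k. (wt k)\<^sup>2 * norm (\<eta> k))"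
    unfolding X0_def X2_def using sum by (rule weighted_interpolation)
  also have "\<dots> \<le> X0 * s\<^sup>2"
    using small pos unfolding s_def by (intro mult_left_mono)
  finally have X2_sq: "X2\<^sup>2 \<le> X0 * s\<^sup>2" .
  have "s\<^sup>2 \<le> (1 / 4)\<^sup>2"
    using s by (intro power_mono) auto
  then have "X0 * s\<^sup>2 \<le> X0 * (1 / 16)"
    using pos by (intro mult_left_mono) (auto simp: power2_eq_square)
  moreover have "(a * W + X2)\<^sup>2 \<le> 2 * (a * W)\<^sup>2 + 2 * X2\<^sup>2"
    using zero_le_power2[of "a * W - X2"] unfolding power2_diff power2_sum by linarith
  ultimately have "X0 \<le> 16 * (a * W)\<^sup>2"
    using X0_le X2_sq by linarith
  then have "X0 * s\<^sup>2 \<le> 16 * (a * W)\<^sup>2 * s\<^sup>2"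
    by (intro mult_right_mono) auto
  with X2_sq have "X2\<^sup>2 \<le> 16 * (a * W)\<^sup>2 * s\<^sup>2"
    by linarith
  also have "\<dots> = (4 * (a * W) * s)\<^sup>2"
    by (simp add: power_mult_distrib)
  finally have "X2\<^sup>2 \<le> (4 * (a * W) * s)\<^sup>2" .
  then have X2_le: "X2 \<le> 4 * (a * W) * s"
    by (rule power2_le_imp_le) (use pos a s in auto)
  have "a\<^sup>2 * (3 / 4) \<le> 2 * ((a * W) * X2) + X2 * X2"
    using a2_le by (simp add: algebra_simps)
  also have "\<dots> \<le> 2 * ((a * W) * (4 * (a * W) * s)) + (4 * (a * W) * s) * (4 * (a * W) * s)"
    using X2_le pos a s by (intro add_mono mult_left_mono mult_mono) auto
  also have "\<dots> = (a * W)\<^sup>2 * (8 * s + 16 * s * s)"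
    by (simp add: power2_eq_square algebra_simps)
  also have "\<dots> \<le> (a * W)\<^sup>2 * (12 * s)"
    using s by (intro mult_left_mono) auto
  also have "\<dots> = a\<^sup>2 * (3 / 8 * (s * (32 * W\<^sup>2)))"
    by (simp add: power_mult_distrib)
  also have "\<dots> < a\<^sup>2 * (3 / 4)"
    using s a by (intro mult_strict_left_mono) auto
  finally show False by simp
qed

section \<open>The stationary equation on Fourier coefficients\<close>

lemma stationary_euler_form:
  assumes st: "stationary_euler \<Omega>"
    and sum: "(\<lambda>k. wt k * norm (fourier_coeff \<Omega> k)) summable_on UNIV"
  shows "euler_form (fourier_coeff \<Omega>) (fourier_coeff \<Omega>) k = 0"
proof -
  obtain \<psi> \<psi>x \<psi>y \<Omega>x \<Omega>y where il: "is_inv_laplacian \<Omega> \<psi>" and dx: "is_dx \<psi> \<psi>x" "is_dx \<Omega> \<Omega>x"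
    and dy: "is_dy \<psi> \<psi>y" "is_dy \<Omega> \<Omega>y"
    and AE: "AE z in torus. - \<psi>y z * \<Omega>x z + \<psi>x z * \<Omega>y z = 0"
    using st unfolding stationary_euler_def by blast
  have L2: "\<psi>x \<in> L2" "\<psi>y \<in> L2" "\<Omega>x \<in> L2" "\<Omega>y \<in> L2"
    using dx dy by (auto simp: is_dx_def is_dy_def)
  have fx: "fourier_coeff \<psi>x j = \<i> * of_int (fst j) * fourier_coeff \<psi> j"
    "fourier_coeff \<Omega>x j = \<i> * of_int (fst j) * fourier_coeff \<Omega> j" for j
    using dx by (cases j; simp add: is_dx_def)+
  have fy: "fourier_coeff \<psi>y j = \<i> * of_int (snd j) * fourier_coeff \<psi> j"
    "fourier_coeff \<Omega>y j = \<i> * of_int (snd j) * fourier_coeff \<Omega> j" for j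
    using dy by (cases j; simp add: is_dy_def)+
  have lap: "- ((of_int (fst j))\<^sup>2 + (of_int (snd j))\<^sup>2) * fourier_coeff \<psi> j = fourier_coeff \<Omega> j" for j
    using il by (cases j) (simp add: is_inv_laplacian_def)
  have mn: "\<bar>of_int (fst j) :: real\<bar> \<le> wt j" "\<bar>of_int (snd j) :: real\<bar> \<le> wt j" for j
  proof -
    have *: "x \<le> 1 + x\<^sup>2" if "x \<ge> 0" for x :: real
    proof -
      have "2 * x \<le> x\<^sup>2 + 1"
        using sum_squares_bound[of x 1] by simp
      with that show ?thesis by linarith
    qed
    have "1 + \<bar>of_int (fst j) :: real\<bar>\<^sup>2 \<le> wt j" "1 + \<bar>of_int (snd j) :: real\<bar>\<^sup>2 \<le> wt j"
      by (simp_all add: wt_def)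
    then show "\<bar>of_int (fst j) :: real\<bar> \<le> wt j" "\<bar>of_int (snd j) :: real\<bar> \<le> wt j"
      using * order_trans abs_ge_zero by blast+
  qed
  have sx: "(\<lambda>j. norm (fourier_coeff \<Omega>x j)) summable_on UNIV"
    by (rule summable_on_comparison_test[OF sum]) (auto simp: fx norm_mult intro!: mult_right_mono mn)
  have sy: "(\<lambda>j. norm (fourier_coeff \<Omega>y j)) summable_on UNIV"
    by (rule summable_on_comparison_test[OF sum]) (auto simp: fy norm_mult intro!: mult_right_mono mn)
  let ?P = "\<lambda>z. \<psi>y z * \<Omega>x z" and ?Q = "\<lambda>z. \<psi>x z * \<Omega>y z"
  have PQ: "fourier_coeff ?P k = fourier_coeff ?Q k"
  proof -
    have "(LINT z|torus. complex_of_real (?P z) * fexp (- k) z) = (LINT z|torus. complex_of_real (?Q z) * fexp (- k) z)"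
    proof (rule integral_cong_AE)
      show "(\<lambda>z. complex_of_real (?P z) * fexp (- k) z) \<in> borel_measurable torus"
        using integrable_fourier[OF integrable_L2_mult[OF L2(2,3)]] by (rule borel_measurable_integrable)
      show "(\<lambda>z. complex_of_real (?Q z) * fexp (- k) z) \<in> borel_measurable torus"
        using integrable_fourier[OF integrable_L2_mult[OF L2(1,4)]] by (rule borel_measurable_integrable)
      show "AE z in torus. complex_of_real (?P z) * fexp (- k) z = complex_of_real (?Q z) * fexp (- k) z"
        using AE by eventually_elim (simp add: add_eq_0_iff2)
    qed
    then show ?thesis
      by (simp add: fourier_coeff_fexp)
  qed
  \<comment> \<open>\<open>fourier_coeff_mult\<close> sums over the frequency of the factor with
    summable coefficients, the vorticity gradient, whereas \<open>euler_form\<close> sums over that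
    of the stream function.\<close>
  have flip: "((\<lambda>j. G (k - j) * H j) has_sum C) UNIV" if "((\<lambda>j. G j * H (k - j)) has_sum C) UNIV"
    for G H :: "int \<times> int \<Rightarrow> complex" and C
    using that by (subst has_sum_reindex_bij_witness[where i = "\<lambda>j. k - j" and j = "\<lambda>j. k - j"
      and h = "\<lambda>j. G j * H (k - j)" and T = UNIV and s' = C]) auto
  have P: "((\<lambda>j. fourier_coeff \<Omega>x (k - j) * fourier_coeff \<psi>y j) has_sum fourier_coeff ?P k) UNIV"
    by (rule flip) (rule fourier_coeff_mult[OF L2(2,3) sx])
  have Q: "((\<lambda>j. fourier_coeff \<Omega>y (k - j) * fourier_coeff \<psi>x j) has_sum fourier_coeff ?P k) UNIV"
    unfolding PQ by (rule flip) (rule fourier_coeff_mult[OF L2(1,4) sy])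
  have summand: "of_real (euler_kernel j k) * fourier_coeff \<Omega> j * fourier_coeff \<Omega> (k - j) =
      fourier_coeff \<Omega>y (k - j) * fourier_coeff \<psi>x j - fourier_coeff \<Omega>x (k - j) * fourier_coeff \<psi>y j" for j
  \<comment> \<open>At j = 0 both sides are 0: the kernel by division by zero, the velocity
    coefficients because a derivative kills the mean.\<close>
  proof (cases "(fst j)\<^sup>2 + (snd j)\<^sup>2 = 0")
    case True
    then have "j = 0"
      by (simp add: prod_eq_iff)
    then show ?thesis
      by (simp add: euler_kernel_def fx fy)
  next
    case False
    define q :: complex where "q = of_int ((fst j)\<^sup>2 + (snd j)\<^sup>2)"
    have q: "q \<noteq> 0"
      unfolding q_def using False by (simp only: of_int_eq_0_iff not_False_eq_True)
    have "fourier_coeff \<Omega> j = - q * fourier_coeff \<psi> j"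
      using lap[of j] by (simp add: q_def)
    moreover have "of_real (euler_kernel j k) = of_int (fst j * snd k - snd j * fst k) / q"
      unfolding euler_kernel_def q_def by (simp only: of_real_divide of_real_of_int_eq)
    moreover have "N / q * (- q * c) = - N * c" for N c
      using q by simp
    ultimately have "of_real (euler_kernel j k) * fourier_coeff \<Omega> j =
        - of_int (fst j * snd k - snd j * fst k) * fourier_coeff \<psi> j"
      by (simp only:)
    note eq = this
    show ?thesis
      unfolding eq by (simp add: fx fy algebra_simps)
  qed
  have "euler_form (fourier_coeff \<Omega>) (fourier_coeff \<Omega>) k = fourier_coeff ?P k - fourier_coeff ?P k"
    unfolding euler_form_def summand infsum_diff[OF has_sum_imp_summable[OF Q] has_sum_imp_summable[OF P]]
      infsumI[OF Q] infsumI[OF P] ..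
  then show ?thesis by simp
qed

text \<open>The Fourier coefficients of \<open>cos y\<close>.\<close>

definition shear_coeff :: "int \<times> int \<Rightarrow> complex" where
  "shear_coeff k = (if k = (0, 1) then 1 / 2 else 0) + (if k = (0, - 1) then 1 / 2 else 0)"

lemma summable_shear_coeff: "(\<lambda>k. wt k * norm (shear_coeff k)) summable_on UNIV"
  by (rule summable_on_cong_neutral[where S = "{(0, 1), (0, - 1)}", THEN iffD1])
    (auto simp: shear_coeff_def)

text \<open>Linearisation at cos y. With the shear in the first slot arises the transport by its
  velocity -sin y, with multiplier m; with it in the second slot, the inverse Laplacian term with m
  / |k -+ (0, 1)|^2. Together they form \<open>linear_coeff\<close> at k -+ (0, 1), and half the
  difference of these neighbours is the multiplication by sin y.\<close>

lemma euler_form_shear: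
  assumes sb: "(\<lambda>k. wt k * norm (b k)) summable_on UNIV"
    and eq: "euler_form (\<lambda>k. shear_coeff k + b k) (\<lambda>k. shear_coeff k + b k) k = 0"
  shows "linear_coeff b (k - (0, 1)) - linear_coeff b (k + (0, 1)) = 2 * euler_form b b k"
proof -
  let ?S = "{(0, 1), (0, - 1)} :: (int \<times> int) set"
  have S: "j \<notin> ?S \<Longrightarrow> shear_coeff j = 0" for j
    by (auto simp: shear_coeff_def)
  note sc = summable_shear_coeff
  note scb = summable_wt_imp(1)[OF sc] summable_wt_imp(1)[OF sb]
  have scb2: "(\<lambda>k. wt k * norm (shear_coeff k + b k)) summable_on UNIV"
  proof (rule summable_on_comparison_test[OF summable_on_add[OF sc sb]])
    show "wt k * norm (shear_coeff k + b k) \<le> wt k * norm (shear_coeff k) + wt k * norm (b k)" for k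
      unfolding distrib_left[symmetric] by (intro mult_left_mono norm_triangle_ineq) simp
  qed auto
  have "0 = euler_form shear_coeff shear_coeff k + euler_form shear_coeff b k
      + (euler_form b shear_coeff k + euler_form b b k)"
    using eq euler_form_add_left[OF scb scb2] euler_form_add_right[OF scb(1) sc sb]
      euler_form_add_right[OF scb(2) sc sb] by simp
  \<comment> \<open>The shear is itself steady: both frequencies are vertical, so their cross
    product is 0.\<close>
  also have "euler_form shear_coeff shear_coeff k = 0"
  proof -
    obtain m n where k: "k = (m, n)" by fastforce
    have "of_real (euler_kernel j k) * shear_coeff j * shear_coeff (k - j) = 0" if "j \<in> ?S" for j
      using that by (cases "m = 0") (auto simp: k euler_kernel_def shear_coeff_def)
    then have "(\<Sum>j\<in>?S. of_real (euler_kernel j k) * shear_coeff j * shear_coeff (k - j)) = 0"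
      by (intro sum.neutral ballI)
    then show ?thesis
      using euler_form_finite_left[of ?S shear_coeff shear_coeff k] S by simp
  qed
  finally have "2 * euler_form b b k = - (2 * euler_form shear_coeff b k) - 2 * euler_form b shear_coeff k"
    by algebra
  also have "2 * euler_form shear_coeff b k =
      of_int (fst k) * b (k + (0, 1)) - of_int (fst k) * b (k - (0, 1))"
    by (subst euler_form_finite_left[where S = ?S])
      (auto simp: S shear_coeff_def euler_kernel_def algebra_simps minus_prod_def plus_prod_def)
  also have "2 * euler_form b shear_coeff k =
      of_real (euler_kernel (k - (0, 1)) k) * b (k - (0, 1))
      + of_real (euler_kernel (k + (0, 1)) k) * b (k + (0, 1))"
    by (subst euler_form_finite_right[where S = ?S])
      (auto simp: S shear_coeff_def algebra_simps minus_prod_def plus_prod_def)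
  also have "euler_kernel (k - (0, 1)) k = of_int (fst k) / of_int ((fst (k - (0, 1)))\<^sup>2 + (snd (k - (0, 1)))\<^sup>2)"
    unfolding euler_kernel_def by (simp add: algebra_simps)
  also have "euler_kernel (k + (0, 1)) k = - of_int (fst k) / of_int ((fst (k + (0, 1)))\<^sup>2 + (snd (k + (0, 1)))\<^sup>2)"
    unfolding euler_kernel_def by (simp add: algebra_simps)
  finally show ?thesis
    by (simp add: linear_coeff_def algebra_simps)
qed

section \<open>From the Sobolev norm to weighted sums of coefficients\<close>

lemma summable_inverse_wt_squared: "(\<lambda>k. 1 / (wt k)\<^sup>2) summable_on UNIV"
proof -
  let ?u = "\<lambda>m :: int. 1 / (1 + (of_int m)\<^sup>2) :: real"
  have "summable (\<lambda>n :: nat. 1 / (1 + (of_nat n)\<^sup>2) :: real)"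
  proof (rule summable_comparison_test)
    show "summable (\<lambda>n :: nat. inverse ((of_nat n)\<^sup>2) :: real)"
      using inverse_power_summable[of 2, where 'a = real] by simp
    have "norm (1 / (1 + (of_nat n)\<^sup>2) :: real) \<le> inverse ((of_nat n)\<^sup>2)" if "n \<ge> 1" for n
    proof -
      have "0 < (of_nat n)\<^sup>2 * (1 + (of_nat n)\<^sup>2 :: real)"
        using that by (intro mult_pos_pos add_pos_nonneg) auto
      then have "1 / (1 + (of_nat n)\<^sup>2) \<le> (1 / (of_nat n)\<^sup>2 :: real)"
        by (intro divide_left_mono) (auto simp: mult.commute)
      then show ?thesis
        by (simp add: inverse_eq_divide abs_of_nonneg)
    qed
    then show "\<exists>N. \<forall>n\<ge>N. norm (1 / (1 + (of_nat n)\<^sup>2) :: real) \<le> inverse ((of_nat n)\<^sup>2)"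
      by blast
  qed
  then have nat: "(\<lambda>n :: nat. ?u (int n)) summable_on UNIV"
    by (subst summable_on_UNIV_nonneg_real_iff) auto
  have 1: "?u summable_on range int"
    using nat by (subst summable_on_reindex) (auto simp: o_def)
  have 2: "?u summable_on range (\<lambda>n. - int n)"
    using nat by (subst summable_on_reindex) (auto simp: o_def inj_on_def)
  have "range int \<union> range (\<lambda>n. - int n) = UNIV"
    by (metis (no_types, lifting) UNIV_eq_I Un_iff int_cases2 rangeI)
  then have u: "?u summable_on UNIV"
    using summable_on_union[OF 1 2] by simp
  have "(\<lambda>(m, n). ?u m * ?u n) summable_on UNIV \<times> UNIV"
  proof (rule summable_on_SigmaI[where g = "\<lambda>m. ?u m * infsum ?u UNIV"])
    show "((\<lambda>n. case (m, n) of (m, n) \<Rightarrow> ?u m * ?u n) has_sum ?u m * infsum ?u UNIV) UNIV" for m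
      using has_sum_cmult_right[OF has_sum_infsum[OF u], of "?u m"] by simp
    show "(\<lambda>m. ?u m * infsum ?u UNIV) summable_on UNIV"
      using u by (rule summable_on_cmult_left)
  qed auto
  then have prod: "(\<lambda>(m, n). ?u m * ?u n) summable_on UNIV"
    by (simp only: UNIV_Times_UNIV)
  show ?thesis
  proof (rule summable_on_comparison_test[OF prod])
    fix k :: "int \<times> int"
    obtain m n where k: "k = (m, n)" by fastforce
    \<comment> \<open>With x = m^2 and y = n^2 the two-dimensional sum is dominated by a product of
      one-dimensional ones.\<close>
    have *: "(1 + x) * (1 + y) \<le> (1 + x + y)\<^sup>2" if "0 \<le> x" "0 \<le> y" for x y :: real
    proof -
      have "0 \<le> x + y + x * x + y * y + x * y"
        using that by simp
      then show ?thesis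
        by (simp add: power2_eq_square algebra_simps)
    qed
    have "1 / (wt k)\<^sup>2 \<le> 1 / ((1 + (of_int m)\<^sup>2) * (1 + (of_int n)\<^sup>2))"
      using *[of "(of_int m)\<^sup>2" "(of_int n)\<^sup>2"]
      by (intro divide_left_mono mult_pos_pos zero_less_power) (auto simp: wt_def k add_pos_nonneg)
    then show "1 / (wt k)\<^sup>2 \<le> (case k of (m, n) \<Rightarrow> ?u m * ?u n)"
      by (simp add: k)
  qed auto
qed

text \<open>Cauchy-Schwarz in additive form: \<open>wt^2\<close> |f| is the product of t / wt and
  \<open>wt^3\<close> |f|, divided by t. The first factor is square summable in dimension two, the
  second by the H^6 bound; the parameter t balances them to make the result linear in t.\<close>

lemma weighted_sum_sobolev:
  fixes f :: "int \<times> int \<Rightarrow> complex"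
  assumes s: "(\<lambda>k. (wt k) ^ 6 * (norm (f k))\<^sup>2) summable_on UNIV"
    and t: "t > 0" and le: "(\<Sum>\<^sub>\<infinity>k. (wt k) ^ 6 * (norm (f k))\<^sup>2) \<le> t\<^sup>2"
  shows "(\<lambda>k. (wt k)\<^sup>2 * norm (f k)) summable_on UNIV"
    and "(\<Sum>\<^sub>\<infinity>k. (wt k)\<^sup>2 * norm (f k)) \<le> t * ((\<Sum>\<^sub>\<infinity>k. 1 / (wt k)\<^sup>2) + 1)"
proof -
  let ?g = "\<lambda>k. t * (1 / (wt k)\<^sup>2) + 1 / t * ((wt k) ^ 6 * (norm (f k))\<^sup>2)"
  have g: "?g summable_on UNIV"
    by (intro summable_on_add summable_on_cmult_right summable_inverse_wt_squared s)
  have b: "(wt k)\<^sup>2 * norm (f k) \<le> ?g k" for k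
  proof -
    define x y where "x = t / wt k" and "y = (wt k) ^ 3 * norm (f k)"
    have xy: "0 \<le> x * y"
      using t by (simp add: x_def y_def)
    have "x * y \<le> x\<^sup>2 + y\<^sup>2"
      using sum_squares_bound[of x y] xy by linarith
    then have "x * y / t \<le> (x\<^sup>2 + y\<^sup>2) / t"
      using t by (intro divide_right_mono) auto
    moreover have "x * y / t = (wt k)\<^sup>2 * norm (f k)"
      using t wt_pos[of k] by (simp add: x_def y_def power2_eq_square power3_eq_cube)
    moreover have "(x\<^sup>2 + y\<^sup>2) / t = ?g k"
      using t by (simp add: x_def y_def power_divide power_mult_distrib add_divide_distrib power2_eq_square)
    ultimately show ?thesis by simp
  qed
  show s2: "(\<lambda>k. (wt k)\<^sup>2 * norm (f k)) summable_on UNIV"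
    by (rule summable_on_comparison_test[OF g b]) simp
  have "(\<Sum>\<^sub>\<infinity>k. (wt k)\<^sup>2 * norm (f k)) \<le> infsum ?g UNIV"
    using s2 g b by (rule infsum_mono)
  also have "\<dots> = t * (\<Sum>\<^sub>\<infinity>k. 1 / (wt k)\<^sup>2) + 1 / t * (\<Sum>\<^sub>\<infinity>k. (wt k) ^ 6 * (norm (f k))\<^sup>2)"
    by (subst infsum_add)
      (auto intro: summable_on_cmult_right summable_inverse_wt_squared s simp only: infsum_cmult_right')
  also have "1 / t * (\<Sum>\<^sub>\<infinity>k. (wt k) ^ 6 * (norm (f k))\<^sup>2) \<le> 1 / t * t\<^sup>2"
    using t le by (intro mult_left_mono) auto
  also have "1 / t * t\<^sup>2 = t"
    using t by (simp add: power2_eq_square)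
  finally show "(\<Sum>\<^sub>\<infinity>k. (wt k)\<^sup>2 * norm (f k)) \<le> t * ((\<Sum>\<^sub>\<infinity>k. 1 / (wt k)\<^sup>2) + 1)"
    by (simp add: distrib_left)
qed

lemma fourier_coeff_trig:
  "fourier_coeff (\<lambda>z. a * (harmonic (- \<i>) (0, int l) z + harmonic 1 (1, 0) z)) k = of_real a * kernel_coeff l k"
  by (simp add: fourier_coeff_scale fourier_coeff_add L2_harmonic fourier_coeff_harmonic kernel_coeff_def)

theorem proposition2p11:
  fixes l :: nat
  assumes "l \<ge> 2"
  shows "\<exists>\<epsilon>0>0. \<forall>\<Omega> :: real \<times> real \<Rightarrow> real.
           periodic2 \<Omega> \<longrightarrow>
           (\<exists>a>0. is_PK (\<lambda>(x, y). \<Omega> (x, y) - cos y) (\<lambda>(x, y). a * (sin (real l * y) + cos x))) \<longrightarrow>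
           (\<lambda>(x, y). \<Omega> (x, y) - cos y) \<in> sobolev 6 \<longrightarrow>
           sobolev_norm 6 (\<lambda>(x, y). \<Omega> (x, y) - cos y) < \<epsilon>0 \<longrightarrow>
           \<not> stationary_euler \<Omega>"
proof -
  define W where "W = (\<Sum>\<^sub>\<infinity>k. wt k * norm (kernel_coeff l k))"
  define S where "S = (\<Sum>\<^sub>\<infinity>k. 1 / (wt k)\<^sup>2)"
  \<comment> \<open>Dividing by S + 1 cancels the constant of \<open>weighted_sum_sobolev\<close>,
    so that X4 meets exactly the threshold of \<open>no_small_solution\<close>.\<close>
  define \<epsilon>0 where "\<epsilon>0 = (1 / (4 + 32 * W\<^sup>2))\<^sup>2 / (S + 1)"
  have S: "0 \<le> S"
    unfolding S_def by (rule infsum_nonneg) simp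
  have "0 < 4 + 32 * W\<^sup>2"
    by (simp add: add_pos_nonneg)
  then have \<epsilon>0: "0 < \<epsilon>0"
    unfolding \<epsilon>0_def using S by (intro divide_pos_pos zero_less_power) auto
  show ?thesis
  proof (intro exI[of _ \<epsilon>0] conjI allI impI notI, rule \<epsilon>0)
    fix \<Omega> :: "real \<times> real \<Rightarrow> real"
    assume pk: "\<exists>a>0. is_PK (\<lambda>(x, y). \<Omega> (x, y) - cos y) (\<lambda>(x, y). a * (sin (real l * y) + cos x))"
      and sob: "(\<lambda>(x, y). \<Omega> (x, y) - cos y) \<in> sobolev 6"
      and small: "sobolev_norm 6 (\<lambda>(x, y). \<Omega> (x, y) - cos y) < \<epsilon>0"
      and st: "stationary_euler \<Omega>"
    define \<omega> where "\<omega> = (\<lambda>z. \<Omega> z - harmonic 1 (0, 1) z)"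
    have \<omega>: "(\<lambda>(x, y). \<Omega> (x, y) - cos y) = \<omega>"
      by (auto simp: \<omega>_def harmonic_def fexp_def)
    obtain a where a: "a > 0" and "is_PK \<omega> (\<lambda>(x, y). a * (sin (real l * y) + cos x))"
      using pk unfolding \<omega> by blast
    define p where "p = (\<lambda>z. a * (harmonic (- \<i>) (0, int l) z + harmonic 1 (1, 0) z))"
    have "(\<lambda>(x, y). a * (sin (real l * y) + cos x)) = p"
      by (auto simp: p_def harmonic_def fexp_def)
    with \<open>is_PK \<omega> _\<close> have pk: "is_PK \<omega> p"
      by simp
    have \<omega>L2: "\<omega> \<in> L2"
      using sob unfolding \<omega> sobolev_def by blast
    have pL2: "p \<in> L2"
      unfolding p_def by (intro L2_scale L2_add L2_harmonic)
    have \<Omega>L2: "\<Omega> \<in> L2"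
      using st unfolding stationary_euler_def is_dx_def by blast
    define b where "b = fourier_coeff \<omega>"
    define \<eta> where "\<eta> = fourier_coeff (\<lambda>z. \<omega> z - p z)"
    have b: "b k = of_real a * kernel_coeff l k + \<eta> k" for k
      unfolding b_def \<eta>_def fourier_coeff_diff[OF \<omega>L2 pL2] by (simp add: p_def fourier_coeff_trig)
    have \<eta>0: "\<eta> k = 0" if "fst k = 0 \<or> (fst k)\<^sup>2 + (snd k)\<^sup>2 = 1" for k
      unfolding \<eta>_def using pk pL2 that by (rule PK_fourier_coeff)
    have \<Omega>: "fourier_coeff \<Omega> = (\<lambda>k. shear_coeff k + b k)"
      unfolding b_def \<omega>_def
      by (auto simp: fourier_coeff_diff[OF \<Omega>L2 L2_harmonic] fourier_coeff_harmonic shear_coeff_def)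

    have weight: "sobolev_weight 6 k = (wt k) ^ 6" for k
      by (simp add: sobolev_weight_def wt_def case_prod_unfold)
    have sb: "(\<lambda>k. (wt k) ^ 6 * (norm (b k))\<^sup>2) summable_on UNIV"
      using sob unfolding \<omega> sobolev_def b_def weight by blast
    \<comment> \<open>Removing the projection leaves each coefficient unchanged or sets it to 0, so
      \<eta> inherits the H^6 bound of \<open>b\<close>.\<close>
    have \<eta>_le: "norm (\<eta> k) \<le> norm (b k)" for k
    proof (cases "fst k = 0 \<or> (fst k)\<^sup>2 + (snd k)\<^sup>2 = 1")
      case False
      then have "kernel_coeff l k = 0"
        by (intro kernel_coeff_support) auto
      then show ?thesis by (simp add: b)
    qed (simp add: \<eta>0)
    have le: "(wt k) ^ 6 * (norm (\<eta> k))\<^sup>2 \<le> (wt k) ^ 6 * (norm (b k))\<^sup>2" for k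
      using \<eta>_le by (intro mult_left_mono power_mono) auto
    have s\<eta>: "(\<lambda>k. (wt k) ^ 6 * (norm (\<eta> k))\<^sup>2) summable_on UNIV"
      by (rule summable_on_comparison_test[OF sb le]) simp
    have "(\<Sum>\<^sub>\<infinity>k. (wt k) ^ 6 * (norm (\<eta> k))\<^sup>2) \<le> (\<Sum>\<^sub>\<infinity>k. (wt k) ^ 6 * (norm (b k))\<^sup>2)"
      using s\<eta> sb le by (rule infsum_mono)
    also have "\<dots> \<le> \<epsilon>0\<^sup>2"
    proof -
      let ?E = "\<Sum>\<^sub>\<infinity>k. (wt k) ^ 6 * (norm (b k))\<^sup>2"
      have E: "0 \<le> ?E"
        by (rule infsum_nonneg) simp
      have "1 * sqrt ?E \<le> 2 * pi * sqrt ?E"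
        using E pi_ge_two by (intro mult_right_mono) auto
      also have "\<dots> < \<epsilon>0"
        using small unfolding \<omega> sobolev_norm_def weight b_def .
      finally have "(sqrt ?E)\<^sup>2 \<le> \<epsilon>0\<^sup>2"
        using E by (intro power_mono) auto
      then show ?thesis
        using E by simp
    qed
    finally have "(\<Sum>\<^sub>\<infinity>k. (wt k) ^ 6 * (norm (\<eta> k))\<^sup>2) \<le> \<epsilon>0\<^sup>2" .
    note X4 = weighted_sum_sobolev[OF s\<eta> \<epsilon>0 this]
    have wts: "(\<lambda>k. wt k * norm (b k)) summable_on UNIV"
    proof (rule weighted_interpolation)
      show "(\<lambda>k. (wt k)\<^sup>2 * norm (b k)) summable_on UNIV"
      proof (rule weighted_sum_sobolev[OF sb])
        \<comment> \<open>Any positive parameter will do, as only summability of \<open>b\<close> is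
          wanted here; the added 1 covers b = 0.\<close>
        show "0 < sqrt (\<Sum>\<^sub>\<infinity>k. (wt k) ^ 6 * (norm (b k))\<^sup>2) + 1"
          by (intro add_nonneg_pos real_sqrt_ge_zero infsum_nonneg) auto
        have "x \<le> (sqrt x + 1)\<^sup>2" if "0 \<le> x" for x :: real
          using that by (simp add: power2_sum)
        then show "(\<Sum>\<^sub>\<infinity>k. (wt k) ^ 6 * (norm (b k))\<^sup>2) \<le> (sqrt (\<Sum>\<^sub>\<infinity>k. (wt k) ^ 6 * (norm (b k))\<^sup>2) + 1)\<^sup>2"
          by (simp add: infsum_nonneg)
      qed
    qed
    have "(\<lambda>k. wt k * norm (fourier_coeff \<Omega> k)) summable_on UNIV"
    proof (rule summable_on_comparison_test)
      show "(\<lambda>k. wt k * norm (shear_coeff k) + wt k * norm (b k)) summable_on UNIV"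
        by (intro summable_on_add summable_shear_coeff wts)
      show "wt k * norm (fourier_coeff \<Omega> k) \<le> wt k * norm (shear_coeff k) + wt k * norm (b k)" for k
        unfolding \<Omega> distrib_left[symmetric] by (intro mult_left_mono norm_triangle_ineq) simp
    qed simp
    from stationary_euler_form[OF st this]
    have "linear_coeff b (k - (0, 1)) - linear_coeff b (k + (0, 1)) = 2 * euler_form b b k" for k
      unfolding \<Omega> by (intro euler_form_shear[OF wts])
    moreover have "(\<Sum>\<^sub>\<infinity>k. (wt k)\<^sup>2 * norm (\<eta> k)) \<le> (1 / (4 + 32 * W\<^sup>2))\<^sup>2"
    proof -
      have "\<epsilon>0 * (S + 1) = (1 / (4 + 32 * W\<^sup>2))\<^sup>2"
        unfolding \<epsilon>0_def using S by simp
      then show ?thesis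
        using X4(2) by (simp add: S_def)
    qed
    ultimately show False
      using no_small_solution[OF assms a b \<eta>0 X4(1) W_def] by blast
  qed
qed

end
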